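(* Suppose single-shot PBFT is run with the FastSync synchronizer with timeout function $F$. Assume that $S_{\rm first}\ge\mathsf{GST}$ and $F(1)>6\delta$. Then all correct processes decide no later than $$S_{\rm last}+\sum_{k=1}^{f}(F(k)+\delta)+5\delta .$$
   Context: Model. There are $n=3f+1$ processes $p_1,\dots,p_n$, at most $f$ of which are faulty (Byzantine, behaving arbitrarily); the others are correct. A quorum is a set of $2f+1$ processes. Processes communicate over authenticated point-to-point links. Partial synchrony: there are a time $\mathsf{GST}$ and a bound $\delta$, both unknown to the protocol, such that after $\mathsf{GST}$ messages between correct processes are delayed by at most $\delta$; before $\mathsf{GST}$ messages may be arbitrarily delayed or lost (self-addressed messages are never lost). Local clocks may drift unboundedly before $\mathsf{GST}$ and do not drift from real time after it. Local processing takes zero time. $\langle m\rangle_i$ denotes $m$ signed by $p_i$; signatures are unforgeable and $\mathsf{hash}$ is collision-resistant (both idealized as perfect). Each correct process has a proposal $\mathtt{myval}()$ satisfying a given predicate $\mathsf{valid}$. Synchronizer. Views are $1,2,\dots$; $0$ denotes an invalid view. The synchronizer issues notifications $\mathtt{new\_view}(v)$ at each correct process, which then enters $v$ and stays in it until it enters another view. Each correct process eventually calls $\mathtt{start}()$; $S_{\rm first}$ and $S_{\rm last}$ are the earliest and latest times when a correct process does so. The timeout function $F:\{0,1,2,\dots\}\to\mathsf{Time}$ is monotone, $F(0)=0$, and for every $\theta$ there is $v$ with $F(v')>\theta$ for all $v'\ge v$. FastSync (code of $p_i$), with retransmission interval $\rho$. Each process has an array $\mathsf{max\_views}[1..n]$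 and variables $\mathsf{view}$, $\mathsf{view}^+$, all initially $0$, and a timer $\mathsf{timer\_view}$, initially not enabled. "All" includes the sender. - $\mathtt{start}()$: if $\mathsf{view}^+=0$, send $\mathtt{WISH}(1)$ to all. - When $\mathsf{timer\_view}$ expires: send $\mathtt{WISH}(\max(\mathsf{view}+1,\mathsf{view}^+))$ to all. - Every $\rho$ units of local time: if $\mathsf{timer\_view}$ is enabled, send $\mathtt{WISH}(\mathsf{view}^+)$ to all; otherwise, if $\mathsf{max\_views}[i]>0$, send $\mathtt{WISH}(\max(\mathsf{view}+1,\mathsf{view}^+))$ to all. - When $\mathtt{WISH}(v)$ is received from $p_j$: let $prev=\mathsf{view}$, $prev^+=\mathsf{view}^+$. If $v>\mathsf{max\_views}[j]$, set $\mathsf{max\_views}[j]:=v$. Set $\mathsf{view}$ (resp. $\mathsf{view}^+$) to the largest value $u$ occurring in $\mathsf{max\_views}$ such that at least $2f+1$ (resp. $f+1$) entries are $\ge u$. If $\mathsf{view}^+=\mathsf{view}$ and $\mathsf{view}>prev$, restart $\mathsf{timer\_view}$ with duration $F(\mathsf{view})$ and issue $\mathtt{new\_view}(\mathsf{view})$. Finally, if $\mathsf{view}^+>prev^+$, send $\mathtt{WISH}(\mathsf{view}^+)$ to all. Single-shot (all-to-all) PBFT (code of $p_i$). $\mathsf{leader}(v)=p_{((v-1)\bmod n)+1}$. Variables $\mathsf{curr\_view},\mathsf{locked\_view}$ are initially $0$; $\mathsf{curr\_val},\mathsf{prepared\_val},\mathsf{cert},\mathsf{voted}$ are initially $\bot$.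 A handler runs when its trigger and precondition hold; messages for views higher than the current one are buffered (for each type and sender, only the one with the highest view is kept). 1. Upon $\mathtt{new\_view}(v)$: $\mathsf{curr\_view}:=v$; $\mathsf{voted}:=$ false; send $\langle\mathtt{NEWLEADER}(v,\mathsf{locked\_view},\mathsf{prepared\_val},\mathsf{cert})\rangle_i$ to $\mathsf{leader}(v)$. 2. (Once per view.) When messages $M=\{\langle\mathtt{NEWLEADER}(v,view_j,val_j,cert_j)\rangle_j\mid p_j\in Q\}$ are received for a quorum $Q$, with $\mathsf{curr\_view}=v$, $p_i=\mathsf{leader}(v)$ and ValidNewLeader$(m)$ for all $m\in M$: if there is $j$ with $view_j=\max\{view_k\mid p_k\in Q\}\ne0$, send $\langle\mathtt{PROPOSE}(v,val_j,M)\rangle_i$ to all; else send $\langle\mathtt{PROPOSE}(v,\mathtt{myval}(),M)\rangle_i$ to all. 3. When $m=\langle\mathtt{PROPOSE}(v,x,\_)\rangle_j$ is received, with $\mathsf{curr\_view}=v$, $\mathsf{voted}=$ false, SafeProposal$(m)$: $\mathsf{curr\_val}:=x$; $\mathsf{voted}:=$ true; send $\langle\mathtt{PREPARED}(v,\mathsf{hash}(x))\rangle_i$ to all. 4. When $C=\{\langle\mathtt{PREPARED}(v,h)\rangle_j\mid p_j\in Q\}$ is received for a quorum $Q$, with $\mathsf{curr\_view}=v$, $\mathsf{voted}=$ true, $\mathsf{hash}(\mathsf{curr\_val})=h$: $\mathsf{prepared\_val}:=\mathsf{curr\_val}$; $\mathsf{locked\_view}:=v$; $\mathsf{cert}:=C$;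 send $\langle\mathtt{COMMITTED}(v,h)\rangle_i$ to all. 5. When $\{\langle\mathtt{COMMITTED}(v,h)\rangle_j\mid p_j\in Q\}$ is received for a quorum $Q$, with $\mathsf{curr\_view}=\mathsf{locked\_view}=v$, $\mathsf{hash}(\mathsf{curr\_val})=h$: decide $\mathsf{curr\_val}$. View-1 optimization: in view $1$ the leader proposes $\mathtt{myval}()$ immediately on entering, without waiting for $\mathtt{NEWLEADER}$ messages (which need not be sent to it), and SafeProposal for view $1$ only requires that the sender is $\mathsf{leader}(1)$ and the value is valid. Predicates: prepared$(C,v,h)$ iff $C=\{\langle\mathtt{PREPARED}(v,h)\rangle_j\mid p_j\in Q\}$ for some quorum $Q$. ValidNewLeader$(\langle\mathtt{NEWLEADER}(v',v,x,C)\rangle_{\_})$ iff $v<v'$ and ($v\ne0$ implies prepared$(C,v,\mathsf{hash}(x))$). SafeProposal$(\langle\mathtt{PROPOSE}(v,x,M)\rangle_i)$ iff $p_i=\mathsf{leader}(v)$, $\mathsf{valid}(x)$, and there is a quorum $Q$ such that $M=\{\langle\mathtt{NEWLEADER}(v,view_j,val_j,cert_j)\rangle_j\mid p_j\in Q\}$, ValidNewLeader$(m)$ for all $m\in M$, and (if $view_j\ne0$ for some $j$, then there is $j$ with $view_j=\max\{view_k\mid p_k\in Q\}$ and $x=val_j$). *)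

theory Defs
  imports Complex_Main
begin

text \<open>
  Processes are the numbers \<open>1, \<dots>, 3f+1\<close>. A run is an interleaving of atomic events, each with a
  real time. Several events may share a time, so that local processing takes no time.
\<close>

type_synonym pid = nat

section \<open>Messages\<close>

text \<open>
  The last argument of each PBFT message is its signer; a constructor application stands for the
  message together with its signature. \<open>None\<close> stands for the undefined value.
\<close>

datatype 'h prepared_msg = Prepared nat 'h pid

datatype ('v, 'h) newleader_msg =
  NewLeader nat nat "'v option" "'h prepared_msg set option" pid

datatype ('v, 'h) pbft_msg =
    is_NEWLEADER: NEWLEADER "('v, 'h) newleader_msg"
  | is_PROPOSE: PROPOSE nat 'v "('v, 'h) newleader_msg set" pid
  | is_PREPARED: PREPARED "'h prepared_msg"
  | is_COMMITTED: COMMITTED nat 'h pid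

datatype ('v, 'h) msg = WISH nat | PBFT "('v, 'h) pbft_msg"

fun msg_view :: "('v, 'h) pbft_msg \<Rightarrow> nat" where
  "msg_view (NEWLEADER (NewLeader v _ _ _ _)) = v"
| "msg_view (PROPOSE v _ _ _) = v"
| "msg_view (PREPARED (Prepared v _ _)) = v"
| "msg_view (COMMITTED v _ _) = v"

fun signer :: "('v, 'h) pbft_msg \<Rightarrow> pid" where
  "signer (NEWLEADER (NewLeader _ _ _ _ j)) = j"
| "signer (PROPOSE _ _ _ j) = j"
| "signer (PREPARED (Prepared _ _ j)) = j"
| "signer (COMMITTED _ _ j) = j"

definition same_slot :: "('v, 'h) pbft_msg \<Rightarrow> ('v, 'h) pbft_msg \<Rightarrow> bool" where
  "same_slot m m' \<longleftrightarrow> signer m = signer m' \<and>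
     is_NEWLEADER m = is_NEWLEADER m' \<and> is_PROPOSE m = is_PROPOSE m' \<and>
     is_PREPARED m = is_PREPARED m' \<and> is_COMMITTED m = is_COMMITTED m'"

text \<open>All signed messages contained in a message, including itself.\<close>

fun newleader_parts :: "('v, 'h) newleader_msg \<Rightarrow> ('v, 'h) pbft_msg set" where
  "newleader_parts (NewLeader v w x C j) =
     insert (NEWLEADER (NewLeader v w x C j)) (case C of None \<Rightarrow> {} | Some C' \<Rightarrow> PREPARED ` C')"

fun signed_parts :: "('v, 'h) msg \<Rightarrow> ('v, 'h) pbft_msg set" where
  "signed_parts (WISH _) = {}"
| "signed_parts (PBFT (NEWLEADER m)) = newleader_parts m"
| "signed_parts (PBFT (PROPOSE v x M j)) = insert (PROPOSE v x M j) (\<Union>m\<in>M. newleader_parts m)"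
| "signed_parts (PBFT (PREPARED m)) = {PREPARED m}"
| "signed_parts (PBFT (COMMITTED v h j)) = {COMMITTED v h j}"

section \<open>System parameters\<close>

record ('v, 'h) params =
  max_faulty :: nat
  correct :: "pid set"
  gst :: real
  delta :: real
  clock :: "pid \<Rightarrow> real \<Rightarrow> real"  \<comment> \<open>local clock reading as a function of real time\<close>
  timeout :: "nat \<Rightarrow> real"
  rho :: real
  valid :: "'v \<Rightarrow> bool"
  hash :: "'v \<Rightarrow> 'h"
  myval :: "pid \<Rightarrow> 'v"

definition procs :: "('v, 'h) params \<Rightarrow> pid set" where
  "procs P = {1..3 * max_faulty P + 1}"

definition faulty :: "('v, 'h) params \<Rightarrow> pid set" where
  "faulty P = procs P - correct P"

definition quorum :: "('v, 'h) params \<Rightarrow> pid set \<Rightarrow> bool" where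
  "quorum P Q \<longleftrightarrow> Q \<subseteq> procs P \<and> card Q = 2 * max_faulty P + 1"

definition leader :: "('v, 'h) params \<Rightarrow> nat \<Rightarrow> pid" where
  "leader P v = (v - 1) mod (3 * max_faulty P + 1) + 1"

text \<open>Perfect collision resistance of the hash is its injectivity.\<close>

definition system :: "('v, 'h) params \<Rightarrow> bool" where
  "system P \<longleftrightarrow>
     correct P \<subseteq> procs P \<and> card (faulty P) \<le> max_faulty P \<and>
     delta P \<ge> 0 \<and> rho P > 0 \<and>
     (\<forall>i\<in>correct P. mono (clock P i) \<and>
        (\<forall>t s. gst P \<le> s \<and> s \<le> t \<longrightarrow> clock P i t - clock P i s = t - s)) \<and>
     mono (timeout P) \<and> timeout P 0 = 0 \<and> (\<forall>\<theta>. \<exists>v. \<forall>v'\<ge>v. timeout P v' > \<theta>) \<and>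
     inj (hash P) \<and> (\<forall>i\<in>correct P. valid P (myval P i))"

section \<open>PBFT predicates\<close>

definition prepared ::
  "('v, 'h) params \<Rightarrow> 'h prepared_msg set \<Rightarrow> nat \<Rightarrow> 'h \<Rightarrow> bool" where
  "prepared P C v h \<longleftrightarrow> (\<exists>Q. quorum P Q \<and> C = (\<lambda>j. Prepared v h j) ` Q)"

fun valid_new_leader :: "('v, 'h) params \<Rightarrow> ('v, 'h) newleader_msg \<Rightarrow> bool" where
  "valid_new_leader P (NewLeader v' v x C _) \<longleftrightarrow>
     v < v' \<and> (v \<noteq> 0 \<longrightarrow> (\<exists>C' y. C = Some C' \<and> x = Some y \<and> prepared P C' v (hash P y)))"

text \<open>The exemption for view 1 is part of the view-1 optimization.\<close>

definition safe_proposal ::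
  "('v, 'h) params \<Rightarrow> nat \<Rightarrow> 'v \<Rightarrow> ('v, 'h) newleader_msg set \<Rightarrow> pid \<Rightarrow> bool" where
  "safe_proposal P v x M i \<longleftrightarrow>
     i = leader P v \<and> valid P x \<and>
     (v \<noteq> 1 \<longrightarrow>
       (\<exists>Q vw vl ct. quorum P Q \<and> M = (\<lambda>j. NewLeader v (vw j) (vl j) (ct j) j) ` Q \<and>
          (\<forall>m\<in>M. valid_new_leader P m) \<and>
          ((\<exists>j\<in>Q. vw j \<noteq> 0) \<longrightarrow> (\<exists>j\<in>Q. vw j = Max (vw ` Q) \<and> vl j = Some x))))"

section \<open>Code of a correct process\<close>

text \<open>
  \<open>timer\<close> is the local time at which the view timer expires, if it is enabled, and \<open>resend_at\<close> the
  local time of the next periodic retransmission. \<open>received\<close> holds the messages of the current view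
  and the buffered ones of higher views; left-over messages of lower views in it are never used.
  \<open>proposed\<close> implements the once-per-view rule of the proposing handler, and \<open>decided\<close> records
  whether the process has decided.
\<close>

record ('v, 'h) pstate =
  max_views :: "pid \<Rightarrow> nat"
  view :: nat
  view_plus :: nat
  timer :: "real option"
  resend_at :: real
  curr_view :: nat
  locked_view :: nat
  curr_val :: "'v option"
  prepared_val :: "'v option"
  cert :: "'h prepared_msg set option"
  voted :: "bool option"
  proposed :: bool
  decided :: "'v option"
  received :: "('v, 'h) pbft_msg set"

text \<open>The phase of the periodic retransmission is arbitrary; \<open>c\<close> is the initial clock reading.\<close>

definition initial :: "('v, 'h) params \<Rightarrow> real \<Rightarrow> ('v, 'h) pstate \<Rightarrow> bool" where
  "initial P c s \<longleftrightarrow> (\<exists>r. c \<le> r \<and> r \<le> c + rho P \<and>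
     s = \<lparr> max_views = (\<lambda>_. 0), view = 0, view_plus = 0, timer = None, resend_at = r,
           curr_view = 0, locked_view = 0, curr_val = None, prepared_val = None, cert = None,
           voted = None, proposed = False, decided = None, received = {} \<rparr>)"

type_synonym ('v, 'h) outs = "(pid \<times> ('v, 'h) msg) set"  \<comment> \<open>destination and message\<close>

definition to_all :: "('v, 'h) params \<Rightarrow> ('v, 'h) msg \<Rightarrow> ('v, 'h) outs" where
  "to_all P m = (\<lambda>j. (j, m)) ` procs P"

definition supported_view :: "('v, 'h) params \<Rightarrow> nat \<Rightarrow> (pid \<Rightarrow> nat) \<Rightarrow> nat" where
  "supported_view P k mv =
     Max {u. (\<exists>j\<in>procs P. mv j = u) \<and> card {j \<in> procs P. mv j \<ge> u} \<ge> k}"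

text \<open>Handler of \<open>new_view\<close>, with the view-1 optimization.\<close>

definition new_view_state ::
  "('v, 'h) params \<Rightarrow> pid \<Rightarrow> nat \<Rightarrow> ('v, 'h) pstate \<Rightarrow> ('v, 'h) pstate" where
  "new_view_state P i v s =
     s\<lparr>curr_view := v, voted := Some False, proposed := (v = 1 \<and> i = leader P v)\<rparr>"

definition new_view_outs ::
  "('v, 'h) params \<Rightarrow> pid \<Rightarrow> nat \<Rightarrow> ('v, 'h) pstate \<Rightarrow> ('v, 'h) outs" where
  "new_view_outs P i v s =
     (if v = 1
      then (if i = leader P v then to_all P (PBFT (PROPOSE v (myval P i) {} i)) else {})
      else {(leader P v,
             PBFT (NEWLEADER (NewLeader v (locked_view s) (prepared_val s) (cert s) i)))})"

definition on_wish ::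
  "('v, 'h) params \<Rightarrow> pid \<Rightarrow> real \<Rightarrow> pid \<Rightarrow> nat \<Rightarrow> ('v, 'h) pstate
     \<Rightarrow> ('v, 'h) pstate \<times> ('v, 'h) outs" where
  "on_wish P i now src v s =
     (let mv = (if v > max_views s src then (max_views s)(src := v) else max_views s);
          w = supported_view P (2 * max_faulty P + 1) mv;
          wp = supported_view P (max_faulty P + 1) mv;
          s1 = s\<lparr>max_views := mv, view := w, view_plus := wp\<rparr>;
          enter = (wp = w \<and> w > view s);
          s2 = (if enter
                then new_view_state P i w (s1\<lparr>timer := Some (clock P i now + timeout P w)\<rparr>)
                else s1);
          o2 = (if enter then new_view_outs P i w s1 else {});
          o3 = (if wp > view_plus s then to_all P (WISH wp) else {})
      in (s2, o2 \<union> o3))"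

text \<open>
  Of the buffered messages of higher views with the same type and signer only the one with the
  highest view is kept (on a tie, the earlier one).
\<close>

definition store :: "('v, 'h) pbft_msg \<Rightarrow> ('v, 'h) pstate \<Rightarrow> ('v, 'h) pstate" where
  "store m s =
     (if msg_view m < curr_view s then s
      else if msg_view m = curr_view s then s\<lparr>received := insert m (received s)\<rparr>
      else if \<exists>m'\<in>received s. same_slot m m' \<and> msg_view m' \<ge> msg_view m then s
      else s\<lparr>received := insert m
               (received s - {m'. same_slot m m' \<and> msg_view m' > curr_view s})\<rparr>)"

text \<open>Guards of the four PBFT handlers that follow \<open>new_view\<close>.\<close>

definition can_propose ::
  "('v, 'h) params \<Rightarrow> pid \<Rightarrow> ('v, 'h) pstate \<Rightarrow> 'v \<Rightarrow> ('v, 'h) newleader_msg set \<Rightarrow> bool" where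
  "can_propose P i s x M \<longleftrightarrow>
     curr_view s \<noteq> 1 \<and> i = leader P (curr_view s) \<and> \<not> proposed s \<and>
     (\<exists>Q vw vl ct. quorum P Q \<and>
        M = (\<lambda>j. NewLeader (curr_view s) (vw j) (vl j) (ct j) j) ` Q \<and>
        NEWLEADER ` M \<subseteq> received s \<and> (\<forall>m\<in>M. valid_new_leader P m) \<and>
        (if Max (vw ` Q) \<noteq> 0 then \<exists>j\<in>Q. vw j = Max (vw ` Q) \<and> vl j = Some x
         else x = myval P i))"

definition can_vote ::
  "('v, 'h) params \<Rightarrow> ('v, 'h) pstate \<Rightarrow> 'v \<Rightarrow> bool" where
  "can_vote P s x \<longleftrightarrow> voted s = Some False \<and>
     (\<exists>M j. PROPOSE (curr_view s) x M j \<in> received s \<and> safe_proposal P (curr_view s) x M j)"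

definition can_lock ::
  "('v, 'h) params \<Rightarrow> ('v, 'h) pstate \<Rightarrow> 'v \<Rightarrow> 'h prepared_msg set \<Rightarrow> bool" where
  "can_lock P s x C \<longleftrightarrow> voted s = Some True \<and> curr_val s = Some x \<and>
     prepared P C (curr_view s) (hash P x) \<and> PREPARED ` C \<subseteq> received s"

definition can_decide :: "('v, 'h) params \<Rightarrow> ('v, 'h) pstate \<Rightarrow> 'v \<Rightarrow> bool" where
  "can_decide P s x \<longleftrightarrow> curr_view s = locked_view s \<and> curr_val s = Some x \<and>
     (\<exists>Q. quorum P Q \<and> (\<forall>j\<in>Q. COMMITTED (curr_view s) (hash P x) j \<in> received s))"

datatype ('v, 'h) action =
    Start
  | TimerExpires
  | Resend
  | Receive pid "('v, 'h) msg"
  | Propose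
  | Vote
  | Lock
  | Decide 'v

inductive step ::
  "('v, 'h) params \<Rightarrow> pid \<Rightarrow> real \<Rightarrow> ('v, 'h) action \<Rightarrow> ('v, 'h) pstate
     \<Rightarrow> ('v, 'h) pstate \<Rightarrow> ('v, 'h) outs \<Rightarrow> bool"
  for P :: "('v, 'h) params" and i :: pid and now :: real where
  start:
    "step P i now Start s s (if view_plus s = 0 then to_all P (WISH 1) else {})"
| timer_expires:
    "timer s = Some d \<Longrightarrow> clock P i now \<ge> d \<Longrightarrow>
     step P i now TimerExpires s (s\<lparr>timer := None\<rparr>)
       (to_all P (WISH (max (view s + 1) (view_plus s))))"
| resend:
    "clock P i now \<ge> resend_at s \<Longrightarrow>
     step P i now Resend s (s\<lparr>resend_at := resend_at s + rho P\<rparr>)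
       (if timer s \<noteq> None then to_all P (WISH (view_plus s))
        else if max_views s i > 0 then to_all P (WISH (max (view s + 1) (view_plus s)))
        else {})"
| receive_wish:
    "on_wish P i now src v s = (s', out) \<Longrightarrow>
     step P i now (Receive src (WISH v)) s s' out"
| receive_pbft:
    "step P i now (Receive src (PBFT m)) s (store m s) {}"
| propose:
    "can_propose P i s x M \<Longrightarrow>
     step P i now Propose s (s\<lparr>proposed := True\<rparr>)
       (to_all P (PBFT (PROPOSE (curr_view s) x M i)))"
| vote:
    "can_vote P s x \<Longrightarrow>
     step P i now Vote s (s\<lparr>curr_val := Some x, voted := Some True\<rparr>)
       (to_all P (PBFT (PREPARED (Prepared (curr_view s) (hash P x) i))))"
| lock:
    "can_lock P s x C \<Longrightarrow>
     step P i now Lock s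
       (s\<lparr>prepared_val := Some x, locked_view := curr_view s, cert := Some C\<rparr>)
       (to_all P (PBFT (COMMITTED (curr_view s) (hash P x) i)))"
| decide:
    "can_decide P s x \<Longrightarrow> step P i now (Decide x) s (s\<lparr>decided := Some x\<rparr>) {}"

text \<open>
  A handler that has to run before time may advance. Locking (in a view) and deciding are obligatory
  only once, but \<^const>\<open>step\<close> also allows them to be repeated, say for another quorum.
\<close>

definition pending :: "('v, 'h) params \<Rightarrow> pid \<Rightarrow> ('v, 'h) pstate \<Rightarrow> bool" where
  "pending P i s \<longleftrightarrow>
     (\<exists>x M. can_propose P i s x M) \<or> (\<exists>x. can_vote P s x) \<or>
     (locked_view s \<noteq> curr_view s \<and> (\<exists>x C. can_lock P s x C)) \<or>
     (decided s = None \<and> (\<exists>x. can_decide P s x))"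

section \<open>Runs\<close>

text \<open>
  Event \<open>k\<close> occurs at time \<open>time R k\<close>, leads from \<open>state R k\<close> to \<open>state R (Suc k)\<close> and sends the
  messages \<open>sent R k\<close>, given as triples of sender, destination and message. Only the states of
  correct processes are meaningful. An event \<open>Adversary\<close> sends messages of faulty processes; with
  no messages it is an idle event.
\<close>

datatype ('v, 'h) event = Step pid "('v, 'h) action" | Adversary

record ('v, 'h) run =
  time :: "nat \<Rightarrow> real"
  event :: "nat \<Rightarrow> ('v, 'h) event"
  state :: "nat \<Rightarrow> pid \<Rightarrow> ('v, 'h) pstate"
  sent :: "nat \<Rightarrow> (pid \<times> pid \<times> ('v, 'h) msg) set"

definition correct_step :: "('v, 'h) params \<Rightarrow> ('v, 'h) run \<Rightarrow> nat \<Rightarrow> pid \<Rightarrow> ('v, 'h) action \<Rightarrow> bool"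
  where
  "correct_step P R k i a \<longleftrightarrow> i \<in> correct P \<and>
     (\<exists>out. step P i (time R k) a (state R k i) (state R (Suc k) i) out \<and>
        sent R k = {(i, j, m) | j m. (j, m) \<in> out}) \<and>
     (\<forall>j\<in>correct P - {i}. state R (Suc k) j = state R k j) \<and>
     (\<forall>src m. a = Receive src m \<longrightarrow> (\<exists>k'<k. (src, i, m) \<in> sent R k'))"

text \<open>
  Links are authenticated, so the sender of a message is a faulty process. Signatures of correct
  processes may only be copied from messages these have sent, to whomever.
\<close>

definition adversary_step :: "('v, 'h) params \<Rightarrow> ('v, 'h) run \<Rightarrow> nat \<Rightarrow> bool" where
  "adversary_step P R k \<longleftrightarrow>
     (\<forall>j\<in>correct P. state R (Suc k) j = state R k j) \<and>
     (\<forall>(src, dst, m)\<in>sent R k. src \<in> faulty P \<and>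
        (\<forall>u\<in>signed_parts m. signer u \<in> correct P \<longrightarrow>
           (\<exists>k'<k. \<exists>dst'. (signer u, dst', PBFT u) \<in> sent R k')))"

text \<open>
  Between \<open>time R k\<close> and \<open>time R (Suc k)\<close> the processes are in \<open>state R (Suc k)\<close>; time cannot pass
  while a handler has to run.
\<close>

definition urgent :: "('v, 'h) params \<Rightarrow> ('v, 'h) run \<Rightarrow> bool" where
  "urgent P R \<longleftrightarrow>
     (\<forall>k t. time R k \<le> t \<and> t < time R (Suc k) \<longrightarrow>
        (\<forall>i\<in>correct P. let s = state R (Suc k) i in
           \<not> pending P i s \<and>
           (\<forall>d. timer s = Some d \<longrightarrow> clock P i t < d) \<and>
           clock P i t < resend_at s))"

definition reliable_links :: "('v, 'h) params \<Rightarrow> ('v, 'h) run \<Rightarrow> bool" where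
  "reliable_links P R \<longleftrightarrow>
     (\<forall>k. \<forall>(i, j, m)\<in>sent R k. i \<in> correct P \<and> j \<in> correct P \<longrightarrow>
        (time R k \<ge> gst P \<longrightarrow>
           (\<exists>k'>k. event R k' = Step j (Receive i m) \<and> time R k' \<le> time R k + delta P)) \<and>
        (i = j \<longrightarrow> (\<exists>k'>k. event R k' = Step j (Receive i m))))"

definition pbft_fastsync_run :: "('v, 'h) params \<Rightarrow> ('v, 'h) run \<Rightarrow> bool" where
  "pbft_fastsync_run P R \<longleftrightarrow>
     mono (time R) \<and> (\<forall>t. \<exists>k. time R k > t) \<and>
     (\<forall>i\<in>correct P. initial P (clock P i (time R 0)) (state R 0 i)) \<and>
     (\<forall>k. case event R k of
            Step i a \<Rightarrow> correct_step P R k i a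
          | Adversary \<Rightarrow> adversary_step P R k) \<and>
     urgent P R \<and> reliable_links P R \<and>
     (\<forall>i\<in>correct P. \<exists>!k. event R k = Step i Start)"

definition start_times :: "('v, 'h) params \<Rightarrow> ('v, 'h) run \<Rightarrow> real set" where
  "start_times P R = {time R k | k i. i \<in> correct P \<and> event R k = Step i Start}"

definition S_first :: "('v, 'h) params \<Rightarrow> ('v, 'h) run \<Rightarrow> real" where
  "S_first P R = Min (start_times P R)"

definition S_last :: "('v, 'h) params \<Rightarrow> ('v, 'h) run \<Rightarrow> real" where
  "S_last P R = Max (start_times P R)"

definition decides_by :: "('v, 'h) run \<Rightarrow> pid \<Rightarrow> real \<Rightarrow> bool" where
  "decides_by R i t \<longleftrightarrow> (\<exists>k x. event R k = Step i (Decide x) \<and> time R k \<le> t)"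

end

theory Submission
  imports Defs
begin

text \<open>
  One of the views \<open>1, \<dots>, f + 1\<close> has a correct leader; let \<open>v\<close> be such a view. No correct process
  sends anything before GST, so every message between correct processes takes at most \<open>\<delta>\<close>.
  The first correct wish for a view above \<open>u\<close> comes from a process whose timer for \<open>u\<close> has expired,
  so it is sent no earlier than \<open>T + F(u)\<close>, where \<open>T\<close> is the time of the first entry to \<open>u\<close>. The
  \<open>f + 1\<close> correct wishes behind that entry are amplified by all correct processes within \<open>\<delta>\<close>, which
  makes all of them enter \<open>u\<close> by \<open>T + 2\<delta>\<close>. Once all correct processes have wished for \<open>u\<close>, all of
  them have entered it after another \<open>\<delta>\<close>, unless a timer for \<open>u\<close> has expired by then, and in that
  case they entered it even earlier. By induction, all are in \<open>v\<close> at the time \<open>\<delta>\<close> plus the sum of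
  \<open>F(k) + \<delta>\<close> over \<open>k < v\<close> after the last start. From the earlier of this time and \<open>T + 2\<delta>\<close>, where
  now \<open>T\<close> is the time of the first entry to \<open>v\<close>, four message delays do not exceed
  \<open>T + 6\<delta> < T + F(v)\<close>, so they suffice for the new-leader, propose, prepared and committed messages
  of all correct processes to get through before anybody leaves \<open>v\<close>.
\<close>

section \<open>Invariants of a correct process\<close>

lemma finite_procs [simp]: "finite (procs P)" and card_procs: "card (procs P) = 3 * max_faulty P + 1"
  by (simp_all add: procs_def)

lemma le_supported_view_iff:
  assumes "1 \<le> k" "k \<le> 3 * max_faulty P + 1"
  shows "v \<le> supported_view P k mv \<longleftrightarrow> k \<le> card {j \<in> procs P. v \<le> mv j}"
proof -
  define S where "S = {u. (\<exists>j\<in>procs P. mv j = u) \<and> card {j \<in> procs P. mv j \<ge> u} \<ge> k}"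
  have fin: "finite S"
    by (rule finite_subset[of _ "mv ` procs P"]) (auto simp: S_def)
  have attained: "\<exists>u\<in>S. v \<le> u" if "k \<le> card {j \<in> procs P. v \<le> mv j}" for v
  proof -
    let ?J = "{j \<in> procs P. v \<le> mv j}"
    have ne: "?J \<noteq> {}" using that assms by (metis card.empty not_one_le_zero order_trans)
    define u where "u = Min (mv ` ?J)"
    have u: "u \<in> mv ` ?J" unfolding u_def by (rule Min_in) (use ne in auto)
    have "?J \<subseteq> {j \<in> procs P. mv j \<ge> u}"
      by (auto simp: u_def intro: Min_le)
    then have "card ?J \<le> card {j \<in> procs P. mv j \<ge> u}"
      by (intro card_mono) auto
    with u that show ?thesis by (auto simp: S_def)
  qed
  have "S \<noteq> {}"
    using attained[of 0] assms card_procs[of P] by auto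
  then have "Max S \<in> S" using fin by (rule Max_in[rotated])
  then have max: "k \<le> card {j \<in> procs P. Max S \<le> mv j}" by (simp add: S_def)
  show ?thesis
  proof
    assume "v \<le> supported_view P k mv"
    then have "v \<le> Max S" by (simp add: supported_view_def S_def)
    then have "card {j \<in> procs P. Max S \<le> mv j} \<le> card {j \<in> procs P. v \<le> mv j}"
      by (intro card_mono) auto
    with max show "k \<le> card {j \<in> procs P. v \<le> mv j}" by simp
  next
    assume "k \<le> card {j \<in> procs P. v \<le> mv j}"
    from attained[OF this] show "v \<le> supported_view P k mv"
      unfolding supported_view_def S_def[symmetric] by (meson Max_ge fin order_trans)
  qed
qed

lemma supported_view_mono:
  assumes "1 \<le> k" "k \<le> 3 * max_faulty P + 1" "\<And>j. mv j \<le> mv' j"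
  shows "supported_view P k mv \<le> supported_view P k mv'"
proof -
  have "k \<le> card {j \<in> procs P. supported_view P k mv \<le> mv j}"
    using le_supported_view_iff[OF assms(1,2)] by blast
  also have "\<dots> \<le> card {j \<in> procs P. supported_view P k mv \<le> mv' j}"
    by (intro card_mono) (auto intro: order_trans assms(3))
  finally show ?thesis using le_supported_view_iff[OF assms(1,2)] by blast
qed

lemma supported_view_antimono:
  assumes "1 \<le> k" "k \<le> k'" "k' \<le> 3 * max_faulty P + 1"
  shows "supported_view P k' mv \<le> supported_view P k mv"
  using assms le_supported_view_iff[of k P] le_supported_view_iff[of k' P]
  by (meson order_refl order_trans)

lemma supported_view_zero:
  assumes "1 \<le> k" "k \<le> 3 * max_faulty P + 1"
  shows "supported_view P k (\<lambda>_. 0) = 0"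
proof (rule ccontr)
  assume "\<not> ?thesis"
  then have "1 \<le> supported_view P k (\<lambda>_. 0)" by simp
  then show False using assms by (simp add: le_supported_view_iff)
qed

lemma on_wish_cases [consumes 1, case_names stay enter]:
  assumes "on_wish P i now src v s = (s', out)"
  obtains mv w wp o3 where
      "mv = (max_views s)(src := max v (max_views s src))"
      "w = supported_view P (2 * max_faulty P + 1) mv"
      "wp = supported_view P (max_faulty P + 1) mv"
      "o3 = (if wp > view_plus s then to_all P (WISH wp) else {})"
      "\<not> (wp = w \<and> w > view s)"
      "s' = s\<lparr>max_views := mv, view := w, view_plus := wp\<rparr>" "out = o3"
  | mv w wp o3 where
      "mv = (max_views s)(src := max v (max_views s src))"
      "w = supported_view P (2 * max_faulty P + 1) mv"
      "wp = supported_view P (max_faulty P + 1) mv"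
      "o3 = (if wp > view_plus s then to_all P (WISH wp) else {})"
      "wp = w" "w > view s"
      "s' = s\<lparr>max_views := mv, view := w, view_plus := wp,
              timer := Some (clock P i now + timeout P w), curr_view := w,
              voted := Some False, proposed := (w = 1 \<and> i = leader P w)\<rparr>"
      "out = new_view_outs P i w s \<union> o3"
proof -
  have mv: "(if v > max_views s src then (max_views s)(src := v) else max_views s) =
    (max_views s)(src := max v (max_views s src))" by (auto simp: max_def)
  let ?mv = "(max_views s)(src := max v (max_views s src))"
  let ?w = "supported_view P (2 * max_faulty P + 1) ?mv"
  let ?wp = "supported_view P (max_faulty P + 1) ?mv"
  note eq = assms[unfolded on_wish_def Let_def mv, symmetric]
  show thesis
  proof (cases "?wp = ?w \<and> ?w > view s")
    case False
    show thesis
      by (rule that(1)[OF refl refl refl refl False]) (use eq False in auto)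
  next
    case True
    show thesis
      by (rule that(2)[OF refl refl refl refl conjunct1[OF True] conjunct2[OF True]])
        (use eq True in \<open>auto simp: new_view_state_def new_view_outs_def\<close>)
  qed
qed

text \<open>In the invariants, \<open>H\<close> is the set of all messages sent so far, with their destinations.\<close>

definition wish_inv :: "('v, 'h) params \<Rightarrow> ('v, 'h) pstate \<Rightarrow> ('v, 'h) outs \<Rightarrow> bool" where
  "wish_inv P s H \<longleftrightarrow>
     view s = supported_view P (2 * max_faulty P + 1) (max_views s) \<and>
     view_plus s = supported_view P (max_faulty P + 1) (max_views s) \<and>
     curr_view s \<le> view s \<and> view s \<le> view_plus s \<and>
     (view s = view_plus s \<longrightarrow> curr_view s = view s) \<and>
     (view_plus s > 0 \<longrightarrow> to_all P (WISH (view_plus s)) \<subseteq> H)"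

lemma wish_inv_initial: "initial P c s \<Longrightarrow> wish_inv P s {}"
  by (auto simp: initial_def wish_inv_def supported_view_zero)

lemma wish_inv_step:
  assumes "wish_inv P s H" "step P i now a s s' out"
  shows "wish_inv P s' (H \<union> out)"
  using assms(2)
proof (cases rule: step.cases)
  case (receive_wish src v)
  let ?mv = "(max_views s)(src := max v (max_views s src))"
  have mono: "view s \<le> supported_view P (2 * max_faulty P + 1) ?mv"
    "view_plus s \<le> supported_view P (max_faulty P + 1) ?mv"
    using assms(1) by (auto simp: wish_inv_def intro!: supported_view_mono)
  have le: "supported_view P (2 * max_faulty P + 1) ?mv \<le> supported_view P (max_faulty P + 1) ?mv"
    by (rule supported_view_antimono) auto
  from receive_wish(2) show ?thesis
    by (cases rule: on_wish_cases)
      (use assms(1) mono le in \<open>auto simp: wish_inv_def to_all_def split: if_splits\<close>)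
next
  case (receive_pbft src m)
  then show ?thesis using assms(1) by (auto simp: wish_inv_def store_def)
qed (use assms(1) in \<open>auto simp: wish_inv_def\<close>)

definition unique_slots :: "('v, 'h) outs \<Rightarrow> bool" where
  "unique_slots H \<longleftrightarrow>
     (\<forall>d d' m m'. (d, PBFT m) \<in> H \<longrightarrow> (d', PBFT m') \<in> H \<longrightarrow> same_slot m m' \<longrightarrow>
        msg_view m = msg_view m' \<longrightarrow> m = m')"

locale pbft_inv =
  fixes P :: "('v, 'h) params" and i :: pid and s :: "('v, 'h) pstate" and H :: "('v, 'h) outs"
  assumes sent: "(d, PBFT m) \<in> H \<Longrightarrow>
      signer m = i \<and> msg_view m \<noteq> 0 \<and> msg_view m \<le> curr_view s"
    and unique: "unique_slots H"
    and proposed_once: "(d, PBFT (PROPOSE (curr_view s) x M j)) \<in> H \<Longrightarrow> proposed s"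
    and voted_once: "(d, PBFT (PREPARED (Prepared (curr_view s) h j))) \<in> H \<Longrightarrow> voted s = Some True"
    and committed_once: "(d, PBFT (COMMITTED (curr_view s) h j)) \<in> H \<Longrightarrow>
      voted s = Some True \<and> (\<exists>x. curr_val s = Some x \<and> h = hash P x)"
    and voted_None: "voted s = None \<longleftrightarrow> curr_view s = 0"
    and proposed_sent:
      "proposed s \<Longrightarrow> \<exists>x M. to_all P (PBFT (PROPOSE (curr_view s) x M i)) \<subseteq> H"
    and voted_sent: "voted s = Some True \<Longrightarrow> \<exists>x M j. curr_val s = Some x \<and>
      to_all P (PBFT (PREPARED (Prepared (curr_view s) (hash P x) i))) \<subseteq> H \<and>
      PROPOSE (curr_view s) x M j \<in> received s \<and> safe_proposal P (curr_view s) x M j"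
    and locked_le: "locked_view s \<le> curr_view s"
    and locked_sent: "locked_view s \<noteq> 0 \<Longrightarrow> \<exists>C y. cert s = Some C \<and> prepared_val s = Some y \<and>
      prepared P C (locked_view s) (hash P y) \<and>
      to_all P (PBFT (COMMITTED (locked_view s) (hash P y) i)) \<subseteq> H"

lemma pbft_inv_initial: "initial P c s \<Longrightarrow> pbft_inv P i s {}"
  by (rule pbft_inv.intro) (auto simp: initial_def unique_slots_def)

lemma quorum_nonempty: "quorum P Q \<Longrightarrow> Q \<noteq> {}"
  by (auto simp: quorum_def)

lemma can_propose_view: "can_propose P i s x M \<Longrightarrow> curr_view s \<noteq> 0"
  using quorum_nonempty[of P] by (fastforce simp: can_propose_def)

lemma leader_in_procs: "leader P v \<in> procs P"
  using mod_less_divisor[of "3 * max_faulty P + 1" "v - 1"]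
  by (auto simp: leader_def procs_def simp del: mod_less_divisor)

lemma same_slot_simps [simp]:
  "same_slot m (PROPOSE v x M j) \<longleftrightarrow> (\<exists>v x M. m = PROPOSE v x M j)"
  "same_slot m (PREPARED (Prepared v h j)) \<longleftrightarrow> (\<exists>v h. m = PREPARED (Prepared v h j))"
  "same_slot m (COMMITTED v h j) \<longleftrightarrow> (\<exists>v h. m = COMMITTED v h j)"
  by (cases m rule: signer.cases; auto simp: same_slot_def)+

lemma same_slot_sym: "same_slot m m' \<Longrightarrow> same_slot m' m"
  by (auto simp: same_slot_def)

lemma unique_slots_extend:
  assumes "\<And>d m. (d, PBFT m) \<in> out \<Longrightarrow> m = m0"
    and "\<And>d m. (d, PBFT m) \<in> H \<Longrightarrow> same_slot m m0 \<Longrightarrow> msg_view m = msg_view m0 \<Longrightarrow> m = m0"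
    and "unique_slots H"
  shows "unique_slots (H \<union> out)"
  using assms same_slot_sym unfolding unique_slots_def by (metis Un_iff)

lemma to_all_iff [simp]: "(d, m) \<in> to_all P m' \<longleftrightarrow> d \<in> procs P \<and> m = m'"
  by (auto simp: to_all_def)

lemma to_all_subset_iff: "to_all P m \<subseteq> H \<longleftrightarrow> (\<forall>j\<in>procs P. (j, m) \<in> H)"
  by (auto simp: to_all_def)

lemmas pbft_invs = pbft_inv.sent pbft_inv.proposed_once pbft_inv.voted_once
  pbft_inv.committed_once pbft_inv.voted_None pbft_inv.proposed_sent pbft_inv.voted_sent
  pbft_inv.locked_le pbft_inv.locked_sent

lemma pbft_inv_no_msg:
  assumes "pbft_inv P i s H"
    and "curr_view s' = curr_view s" "voted s' = voted s" "proposed s' = proposed s"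
      "curr_val s' = curr_val s" "locked_view s' = locked_view s" "cert s' = cert s"
      "prepared_val s' = prepared_val s"
    and "\<And>m. m \<in> received s \<Longrightarrow> msg_view m = curr_view s \<Longrightarrow> m \<in> received s'"
    and "\<And>d m. (d, PBFT m) \<notin> out"
  shows "pbft_inv P i s' (H \<union> out)"
proof -
  have eq: "(d, PBFT m) \<in> H \<union> out \<longleftrightarrow> (d, PBFT m) \<in> H" for d m
    using assms by auto
  show ?thesis
  proof (rule pbft_inv.intro, unfold eq assms(2-8))
    show "unique_slots (H \<union> out)"
      using pbft_inv.unique[OF assms(1)] unfolding unique_slots_def eq .
  next
    show "\<exists>x M j. curr_val s = Some x \<and>
        to_all P (PBFT (PREPARED (Prepared (curr_view s) (hash P x) i))) \<subseteq> H \<union> out \<and>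
        PROPOSE (curr_view s) x M j \<in> received s' \<and> safe_proposal P (curr_view s) x M j"
      if "voted s = Some True"
      using pbft_inv.voted_sent[OF assms(1) that] assms(9) by (metis le_supI1 msg_view.simps(2))
  qed (use pbft_invs[OF assms(1)] in blast)+
qed

lemma store_simps [simp]:
  "curr_view (store m s) = curr_view s" "voted (store m s) = voted s"
  "proposed (store m s) = proposed s" "curr_val (store m s) = curr_val s"
  "locked_view (store m s) = locked_view s" "cert (store m s) = cert s"
  "prepared_val (store m s) = prepared_val s" "decided (store m s) = decided s"
  "max_views (store m s) = max_views s" "view (store m s) = view s"
  "view_plus (store m s) = view_plus s" "timer (store m s) = timer s"
  by (simp_all add: store_def)

lemma pbft_inv_step:
  assumes inv: "pbft_inv P i s H" and view: "curr_view s \<le> view s"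
    and step: "step P i now a s s' out"
  shows "pbft_inv P i s' (H \<union> out)"
  using step
proof (cases rule: step.cases)
  case (receive_wish src v)
  from receive_wish(2) show ?thesis
  proof (cases rule: on_wish_cases)
    case (stay mv w wp o3)
    show ?thesis
      by (rule pbft_inv_no_msg[OF inv]) (auto simp: stay)
  next
    case (enter mv w wp o3)
    have bound: "msg_view m < w" if "(d, PBFT m) \<in> H" for d m
      using pbft_inv.sent[OF inv that] view \<open>w > view s\<close> by simp
    have wpos: "w \<noteq> 0" and lw: "locked_view s \<le> w"
      using pbft_inv.locked_le[OF inv] view \<open>w > view s\<close> by auto
    have o3: "(d, PBFT m) \<notin> o3" for d m
      by (auto simp: enter(4))
    have outs: "signer m = i \<and> msg_view m = w \<and> (is_PROPOSE m \<longrightarrow> w = 1 \<and> i = leader P w) \<and>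
        \<not> is_PREPARED m \<and> \<not> is_COMMITTED m"
      if "(d, PBFT m) \<in> new_view_outs P i w s" for d m
      using that by (auto simp: new_view_outs_def split: if_splits)
    define m0 where "m0 = (if w = 1 then PROPOSE w (myval P i) {} i else
      NEWLEADER (NewLeader w (locked_view s) (prepared_val s) (cert s) i))"
    have m0: "m = m0" if "(d, PBFT m) \<in> out" for d m
      using that o3 by (auto simp: enter m0_def new_view_outs_def split: if_splits)
    have "msg_view m0 = w" by (simp add: m0_def)
    have uniq: "unique_slots (H \<union> out)"
      by (rule unique_slots_extend[where ?m0.0 = m0])
        (use m0 bound \<open>msg_view m0 = w\<close> pbft_inv.unique[OF inv] in \<open>(assumption | fastforce)+\<close>)
    have new: "(d, PBFT m) \<in> new_view_outs P i w s"
      if "(d, PBFT m) \<in> H \<union> out" "msg_view m = w" for d m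
      using that bound o3 by (auto simp: enter(8))
    have c: "curr_view s' = w" "voted s' = Some False" "proposed s' = (w = 1 \<and> i = leader P w)"
      "locked_view s' = locked_view s" "cert s' = cert s" "prepared_val s' = prepared_val s"
      by (auto simp: enter)
    have 1: "signer m = i \<and> msg_view m \<noteq> 0 \<and> msg_view m \<le> w" if "(d, PBFT m) \<in> H \<union> out" for d m
      using that pbft_inv.sent[OF inv, of d m] bound[of d m] outs[of d m] o3 wpos by (auto simp: enter(8))
    have 3: "(d, PBFT (PROPOSE w x M j)) \<in> H \<union> out \<Longrightarrow> w = 1 \<and> i = leader P w" for d x M j
      using new outs by fastforce
    have 4: "(d, PBFT (PREPARED (Prepared w h j))) \<notin> H \<union> out" for d h j
      using new outs by fastforce
    have 5: "(d, PBFT (COMMITTED w h j)) \<notin> H \<union> out" for d h j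
      using new outs by fastforce
    have 7: "w = 1 \<and> i = leader P w \<longrightarrow> (\<exists>x M. to_all P (PBFT (PROPOSE w x M i)) \<subseteq> H \<union> out)"
      by (auto simp: enter(8) new_view_outs_def)
    have 9: "locked_view s \<noteq> 0 \<longrightarrow> (\<exists>C y. cert s = Some C \<and> prepared_val s = Some y \<and>
        prepared P C (locked_view s) (hash P y) \<and>
        to_all P (PBFT (COMMITTED (locked_view s) (hash P y) i)) \<subseteq> H \<union> out)"
      using pbft_inv.locked_sent[OF inv] by blast
    show ?thesis
      by (rule pbft_inv.intro, unfold c)
        (use 1 in blast, fact uniq, use 3 in blast, use 4 in blast, use 5 in blast,
         use wpos in simp, use 7 in simp, simp, fact lw, use 9 in simp)
  qed
next
  case (propose x M)
  have cv: "curr_view s \<noteq> 0" and np: "\<not> proposed s"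
    using propose(4) can_propose_view[OF propose(4)] by (simp_all add: can_propose_def)
  have uniq: "unique_slots (H \<union> out)"
    by (rule unique_slots_extend[where ?m0.0 = "PROPOSE (curr_view s) x M i", OF _ _ pbft_inv.unique[OF inv]])
      (use np pbft_inv.proposed_once[OF inv] in \<open>fastforce simp: propose(3)\<close>)+
  show ?thesis
    unfolding propose(2,3)
    by (rule pbft_inv.intro)
      (use pbft_inv.sent[OF inv] cv in fastforce,
       fact uniq[unfolded propose(3)],
       use pbft_inv.proposed_once[OF inv]  in fastforce,
       use pbft_inv.voted_once[OF inv]  in fastforce,
       use pbft_inv.committed_once[OF inv]  in fastforce,
       use pbft_inv.voted_None[OF inv]  in fastforce,
       (auto)[1],
       use pbft_inv.voted_sent[OF inv]  in fastforce,
       use pbft_inv.locked_le[OF inv]  in fastforce,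
       use pbft_inv.locked_sent[OF inv]  in fastforce)
next
  case (vote x)
  have nv: "voted s = Some False"
    and ex: "\<exists>M j. PROPOSE (curr_view s) x M j \<in> received s \<and>
      safe_proposal P (curr_view s) x M j"
    using vote(4) by (auto simp: can_vote_def)
  then have cv: "curr_view s \<noteq> 0" using pbft_inv.voted_None[OF inv] by auto
  have uniq: "unique_slots (H \<union> out)"
    by (rule unique_slots_extend[where ?m0.0 = "PREPARED (Prepared (curr_view s) (hash P x) i)", OF _ _ pbft_inv.unique[OF inv]])
      (use nv pbft_inv.voted_once[OF inv] in \<open>fastforce simp: vote(3)\<close>)+
  show ?thesis
    unfolding vote(2,3)
    by (rule pbft_inv.intro)
      (use pbft_inv.sent[OF inv] cv nv in fastforce,
       fact uniq[unfolded vote(3)],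
       use pbft_inv.proposed_once[OF inv]  in fastforce,
       use pbft_inv.voted_once[OF inv] nv in fastforce,
       use pbft_inv.committed_once[OF inv] nv in fastforce,
       use pbft_inv.voted_None[OF inv] cv in fastforce,
       use pbft_inv.proposed_sent[OF inv]  in fastforce,
       (use ex in auto)[1],
       use pbft_inv.locked_le[OF inv]  in fastforce,
       use pbft_inv.locked_sent[OF inv]  in fastforce)
next
  case (lock x C)
  have v: "voted s = Some True" "curr_val s = Some x" "prepared P C (curr_view s) (hash P x)"
    using lock(4) by (auto simp: can_lock_def)
  then have cv: "curr_view s \<noteq> 0" using pbft_inv.voted_None[OF inv] by auto
  have uniq: "unique_slots (H \<union> out)"
    by (rule unique_slots_extend[where ?m0.0 = "COMMITTED (curr_view s) (hash P x) i", OF _ _ pbft_inv.unique[OF inv]])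
      (use v pbft_inv.committed_once[OF inv] in \<open>fastforce simp: lock(3)\<close>)+
  show ?thesis
    unfolding lock(2,3)
    by (rule pbft_inv.intro)
      (use pbft_inv.sent[OF inv] cv v in fastforce,
       fact uniq[unfolded lock(3)],
       use pbft_inv.proposed_once[OF inv]  in fastforce,
       use pbft_inv.voted_once[OF inv]  in fastforce,
       use pbft_inv.committed_once[OF inv] v in fastforce,
       use pbft_inv.voted_None[OF inv]  in fastforce,
       use pbft_inv.proposed_sent[OF inv]  in fastforce,
       use pbft_inv.voted_sent[OF inv]  in fastforce,
       use pbft_inv.locked_le[OF inv]  in fastforce,
       (use v in auto)[1])
next
  case (receive_pbft src m)
  show ?thesis
    by (rule pbft_inv_no_msg[OF inv]) (auto simp: receive_pbft store_def)
qed (rule pbft_inv_no_msg[OF inv]; auto split: if_splits; fail)+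

definition justified ::
  "('v, 'h) params \<Rightarrow> nat \<Rightarrow> 'v \<Rightarrow> ('v, 'h) newleader_msg set \<Rightarrow> pid \<Rightarrow> bool" where
  "justified P v x M i \<longleftrightarrow> i = leader P v \<and>
     (if v = 1 then x = myval P i
      else \<exists>Q vw vl ct. quorum P Q \<and> M = (\<lambda>j. NewLeader v (vw j) (vl j) (ct j) j) ` Q \<and>
        (\<forall>m\<in>M. valid_new_leader P m) \<and>
        (if Max (vw ` Q) \<noteq> 0 then \<exists>j\<in>Q. vw j = Max (vw ` Q) \<and> vl j = Some x
         else x = myval P i))"

locale content_inv =
  fixes P :: "('v, 'h) params" and i :: pid and s :: "('v, 'h) pstate" and H :: "('v, 'h) outs"
  assumes newleader_valid: "(d, PBFT (NEWLEADER m)) \<in> H \<Longrightarrow> valid_new_leader P m"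
    and prepared_valid: "(d, PBFT (PREPARED (Prepared v h j))) \<in> H \<Longrightarrow> \<exists>x. h = hash P x \<and> valid P x"
    and proposal_justified: "(d, PBFT (PROPOSE v x M j)) \<in> H \<Longrightarrow> justified P v x M i"
    and newleader_sent: "2 \<le> curr_view s \<Longrightarrow> \<exists>w x C. (leader P (curr_view s),
        PBFT (NEWLEADER (NewLeader (curr_view s) w x C i))) \<in> H"
    and first_proposed: "curr_view s = 1 \<Longrightarrow> i = leader P 1 \<Longrightarrow> proposed s"

lemma content_inv_initial: "initial P c s \<Longrightarrow> content_inv P i s {}"
  by (rule content_inv.intro) (auto simp: initial_def)

lemmas content_invs = content_inv.newleader_valid content_inv.prepared_valid
  content_inv.proposal_justified content_inv.newleader_sent content_inv.first_proposed

lemma content_inv_no_msg: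
  assumes "content_inv P i s H" "curr_view s' = curr_view s" "proposed s' = proposed s"
    "\<And>d m. (d, PBFT m) \<notin> out"
  shows "content_inv P i s' (H \<union> out)"
proof -
  have eq: "(d, PBFT m) \<in> H \<union> out \<longleftrightarrow> (d, PBFT m) \<in> H" for d m
    using assms by auto
  show ?thesis
    by (rule content_inv.intro, unfold eq assms(2,3)) (use content_invs[OF assms(1)] in blast)+
qed

lemma content_inv_step:
  assumes inv: "content_inv P i s H" and pinv: "pbft_inv P i s H" and view: "curr_view s \<le> view s"
    and step: "step P i now a s s' out"
  shows "content_inv P i s' (H \<union> out)"
  using step
proof (cases rule: step.cases)
  case (receive_wish src v)
  from receive_wish(2) show ?thesis
  proof (cases rule: on_wish_cases)
    case (stay mv w wp o3)
    show ?thesis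
      by (rule content_inv_no_msg[OF inv]) (auto simp: stay)
  next
    case (enter mv w wp o3)
    have *: "valid_new_leader P (NewLeader w (locked_view s) (prepared_val s) (cert s) i)"
      using pbft_inv.locked_le[OF pinv] pbft_inv.locked_sent[OF pinv] view \<open>w > view s\<close> by auto
    have 1: "valid_new_leader P m" if "(d, PBFT (NEWLEADER m)) \<in> out" for d m
      using that * by (auto simp: enter(4,8) new_view_outs_def split: if_splits)
    have 2: "(d, PBFT (PREPARED m)) \<notin> out" for d m
      by (auto simp: enter(4,8) new_view_outs_def)
    have 3: "justified P v' x M i" if "(d, PBFT (PROPOSE v' x M j)) \<in> out" for d v' x M j
      using that by (auto simp: enter(4,8) new_view_outs_def justified_def split: if_splits)
    have 4: "\<exists>w x C. (leader P (curr_view s'), PBFT (NEWLEADER (NewLeader (curr_view s') w x C i))) \<in> H \<union> out"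
      if "2 \<le> curr_view s'"
      using that by (auto simp: enter(7,8) new_view_outs_def)
    show ?thesis
      by (rule content_inv.intro)
        (use content_invs[OF inv] 1 2 3 in blast, use content_invs[OF inv] 1 2 3 in blast,
         use content_invs[OF inv] 1 2 3 in blast, fact 4, simp add: enter(7))
  qed
next
  case (propose x M)
  obtain Q vw vl ct where "curr_view s \<noteq> 1" "i = leader P (curr_view s)" and
    Q: "quorum P Q" "M = (\<lambda>j. NewLeader (curr_view s) (vw j) (vl j) (ct j) j) ` Q"
      "\<forall>m\<in>M. valid_new_leader P m"
      "if Max (vw ` Q) \<noteq> 0 then \<exists>j\<in>Q. vw j = Max (vw ` Q) \<and> vl j = Some x
       else x = myval P i"
    using propose(4) unfolding can_propose_def by (elim exE conjE) (rule that)
  then have *: "justified P (curr_view s) x M i"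
    unfolding justified_def if_not_P[OF \<open>curr_view s \<noteq> 1\<close>]
    by (intro conjI exI[of _ Q] exI[of _ vw] exI[of _ vl] exI[of _ ct])
  show ?thesis
    unfolding propose(2,3)
    by (rule content_inv.intro)
      (use content_inv.newleader_valid[OF inv]  in fastforce,
       use content_inv.prepared_valid[OF inv]  in fastforce,
       use content_inv.proposal_justified[OF inv] * in fastforce,
       use content_inv.newleader_sent[OF inv] in fastforce,
       use content_inv.first_proposed[OF inv] in simp)
next
  case (vote x)
  have *: "valid P x" using vote(4) by (auto simp: can_vote_def safe_proposal_def)
  show ?thesis
    unfolding vote(2,3)
    by (rule content_inv.intro)
      (use content_inv.newleader_valid[OF inv]  in fastforce,
       use content_inv.prepared_valid[OF inv] * in fastforce,
       use content_inv.proposal_justified[OF inv]  in fastforce,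
       use content_inv.newleader_sent[OF inv] in fastforce,
       use content_inv.first_proposed[OF inv] in simp)
next
  case (lock x C)
  show ?thesis
    unfolding lock(2,3)
    by (rule content_inv.intro)
      (use content_inv.newleader_valid[OF inv]  in fastforce,
       use content_inv.prepared_valid[OF inv]  in fastforce,
       use content_inv.proposal_justified[OF inv]  in fastforce,
       use content_inv.newleader_sent[OF inv] in fastforce,
       use content_inv.first_proposed[OF inv] in simp)
next
  case (receive_pbft src m)
  show ?thesis
    by (rule content_inv_no_msg[OF inv]) (auto simp: receive_pbft)
qed (rule content_inv_no_msg[OF inv]; auto split: if_splits; fail)+

section \<open>Synchronous runs\<close>

definition sent_upto :: "('v, 'h) run \<Rightarrow> pid \<Rightarrow> nat \<Rightarrow> ('v, 'h) outs" where
  "sent_upto R i k = {(j, m). \<exists>k'<k. (i, j, m) \<in> sent R k'}"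

text \<open>\<open>state R (events_by R t)\<close> is the state after all events that occur up to time \<open>t\<close>.\<close>

definition events_by :: "('v, 'h) run \<Rightarrow> real \<Rightarrow> nat" where
  "events_by R t = (LEAST k. time R k > t)"

definition entry :: "('v, 'h) run \<Rightarrow> pid \<Rightarrow> nat \<Rightarrow> nat \<Rightarrow> bool" where
  "entry R i v k \<longleftrightarrow> curr_view (state R k i) < v \<and> curr_view (state R (Suc k) i) = v"

lemma sent_upto_0 [simp]: "sent_upto R i 0 = {}"
  by (auto simp: sent_upto_def)

lemma sent_upto_mono: "k \<le> k' \<Longrightarrow> sent_upto R i k \<subseteq> sent_upto R i k'"
  unfolding sent_upto_def by (auto intro: less_le_trans)

lemma sent_upto_Suc: "sent_upto R i (Suc k) = sent_upto R i k \<union> {(j, m). (i, j, m) \<in> sent R k}"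
  by (auto simp: sent_upto_def less_Suc_eq)

locale synchronous_run =
  fixes P :: "('v, 'h) params" and R :: "('v, 'h) run"
  assumes sys: "system P" and run: "pbft_fastsync_run P R"
    and first_start: "S_first P R \<ge> gst P"
    and timeout_1: "timeout P 1 > 6 * delta P"
begin

lemma time_mono: "k \<le> k' \<Longrightarrow> time R k \<le> time R k'"
  using run by (auto simp: pbft_fastsync_run_def dest: monoD)

lemma less_events_by_iff: "k < events_by R t \<longleftrightarrow> time R k \<le> t"
proof -
  have "\<exists>k. time R k > t" using run by (auto simp: pbft_fastsync_run_def)
  then have "time R (events_by R t) > t" unfolding events_by_def by (rule LeastI_ex)
  moreover have "\<not> time R k > t" if "k < events_by R t" for k
    using that not_less_Least unfolding events_by_def by blast
  ultimately show ?thesis using time_mono by (meson leD leI order_less_le_trans)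
qed

lemma events_by_mono: "t \<le> t' \<Longrightarrow> events_by R t \<le> events_by R t'"
  using less_events_by_iff by (meson leI less_irrefl order_less_le_trans order_trans)

lemma correct_procs: "correct P \<subseteq> procs P" and finite_correct: "finite (correct P)"
  and finite_faulty: "finite (faulty P)" and card_faulty: "card (faulty P) \<le> max_faulty P"
  and delta_nonneg: "0 \<le> delta P"
  using sys finite_subset[of "correct P" "procs P"] by (auto simp: system_def faulty_def)

lemma card_correct: "2 * max_faulty P + 1 \<le> card (correct P)"
proof -
  have "card (faulty P) = card (procs P) - card (correct P)"
    unfolding faulty_def using correct_procs finite_correct by (simp add: card_Diff_subset)
  then show ?thesis using card_faulty card_procs[of P] by linarith
qed

lemma timeout_ge: "1 \<le> v \<Longrightarrow> timeout P 1 \<le> timeout P v"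
  using sys by (auto simp: system_def dest: monoD)

lemma supported_correct:
  assumes "v \<le> supported_view P (max_faulty P + 1) mv" "0 < v"
  shows "\<exists>j\<in>correct P. v \<le> mv j"
proof (rule ccontr)
  assume "\<not> ?thesis"
  then have "{j \<in> procs P. v \<le> mv j} \<subseteq> faulty P" by (auto simp: faulty_def)
  from card_mono[OF finite_faulty this] card_faulty
  show False using assms(1) by (simp add: le_supported_view_iff)
qed

lemma all_correct_supported:
  assumes "\<forall>j\<in>correct P. v \<le> mv j"
  shows "v \<le> supported_view P (2 * max_faulty P + 1) mv"
proof -
  have "card (correct P) \<le> card {j \<in> procs P. v \<le> mv j}"
    using assms correct_procs by (intro card_mono) auto
  then show ?thesis using card_correct by (simp add: le_supported_view_iff)
qed

lemma supported_transfer: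
  assumes "v \<le> supported_view P (2 * max_faulty P + 1) mv"
    and "\<And>j. j \<in> correct P \<Longrightarrow> v \<le> mv j \<Longrightarrow> v \<le> mv' j"
  shows "v \<le> supported_view P (max_faulty P + 1) mv'"
proof -
  have "card {j \<in> procs P. v \<le> mv j} \<le> card ({j \<in> procs P. v \<le> mv' j} \<union> faulty P)"
    using assms(2) finite_faulty by (intro card_mono) (auto simp: faulty_def)
  also have "\<dots> \<le> card {j \<in> procs P. v \<le> mv' j} + max_faulty P"
    using card_Un_le card_faulty by (meson add_left_mono order_trans)
  finally show ?thesis using assms(1) by (simp add: le_supported_view_iff)
qed

lemma event_run:
  "case event R k of Step i a \<Rightarrow> correct_step P R k i a | Adversary \<Rightarrow> adversary_step P R k"
  using run unfolding pbft_fastsync_run_def by blast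

lemma event_cases:
  assumes "i \<in> correct P"
  obtains (idle) "state R (Suc k) i = state R k i" "sent_upto R i (Suc k) = sent_upto R i k"
      "\<And>j m. (i, j, m) \<notin> sent R k" "\<And>a. event R k \<noteq> Step i a"
  | (active) a out where "event R k = Step i a"
      "step P i (time R k) a (state R k i) (state R (Suc k) i) out"
      "sent_upto R i (Suc k) = sent_upto R i k \<union> out"
      "\<And>j m. (i, j, m) \<in> sent R k \<longleftrightarrow> (j, m) \<in> out"
      "\<And>src m. a = Receive src m \<Longrightarrow> \<exists>k'<k. (src, i, m) \<in> sent R k'"
proof (cases "event R k")
  case (Step j a)
  then have cs: "correct_step P R k j a"
    using event_run[of k] by simp
  show ?thesis
  proof (cases "j = i")
    case True
    from cs obtain out where out: "step P i (time R k) a (state R k i) (state R (Suc k) i) out"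
        "sent R k = {(i, j, m) | j m. (j, m) \<in> out}"
        "\<forall>src m. a = Receive src m \<longrightarrow> (\<exists>k'<k. (src, i, m) \<in> sent R k')"
      unfolding correct_step_def True by blast
    show ?thesis
      by (rule active[of a out]) (use out Step True in \<open>auto simp: sent_upto_Suc\<close>)
  next
    case False
    show ?thesis
      by (rule idle) (use cs False assms Step in \<open>auto simp: sent_upto_Suc correct_step_def\<close>)
  qed
next
  case Adversary
  then have cs: "adversary_step P R k"
    using event_run[of k] by simp
  have none: "(i, j, m) \<notin> sent R k" for j m
    using cs assms by (fastforce simp: adversary_step_def faulty_def)
  show ?thesis
    by (rule idle) (use cs assms Adversary none in \<open>auto simp: sent_upto_Suc adversary_step_def\<close>)
qed

lemma initial_state: "i \<in> correct P \<Longrightarrow> initial P (clock P i (time R 0)) (state R 0 i)"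
  using run by (auto simp: pbft_fastsync_run_def)

lemma wish_inv_run:
  assumes "i \<in> correct P"
  shows "wish_inv P (state R k i) (sent_upto R i k)"
proof (induction k)
  case 0
  show ?case using wish_inv_initial[OF initial_state[OF assms]] by simp
next
  case (Suc k)
  from assms show ?case
  proof (cases rule: event_cases[of i k])
    case idle
    then show ?thesis using Suc by simp
  next
    case (active a out)
    show ?thesis using wish_inv_step[OF Suc active(2)] unfolding active(3) .
  qed
qed

lemma curr_view_le: "i \<in> correct P \<Longrightarrow> curr_view (state R k i) \<le> view (state R k i)"
  and view_le: "i \<in> correct P \<Longrightarrow> view (state R k i) \<le> view_plus (state R k i)"
  and curr_view_eq: "i \<in> correct P \<Longrightarrow> view (state R k i) = view_plus (state R k i) \<Longrightarrow>
    curr_view (state R k i) = view (state R k i)"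
  and view_eq: "i \<in> correct P \<Longrightarrow>
    view (state R k i) = supported_view P (2 * max_faulty P + 1) (max_views (state R k i))"
  and view_plus_eq: "i \<in> correct P \<Longrightarrow>
    view_plus (state R k i) = supported_view P (max_faulty P + 1) (max_views (state R k i))"
  and view_plus_sent: "i \<in> correct P \<Longrightarrow> view_plus (state R k i) > 0 \<Longrightarrow>
    to_all P (WISH (view_plus (state R k i))) \<subseteq> sent_upto R i k"
  using wish_inv_run[of i k] unfolding wish_inv_def by blast+

lemma pbft_inv_run:
  assumes "i \<in> correct P"
  shows "pbft_inv P i (state R k i) (sent_upto R i k)"
proof (induction k)
  case 0
  show ?case using pbft_inv_initial[OF initial_state[OF assms]] by simp
next
  case (Suc k)
  from assms show ?case
  proof (cases rule: event_cases[of i k])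
    case idle
    then show ?thesis using Suc by simp
  next
    case (active a out)
    show ?thesis
      using pbft_inv_step[OF Suc curr_view_le[OF assms] active(2)] unfolding active(3) .
  qed
qed

lemma content_inv_run:
  assumes "i \<in> correct P"
  shows "content_inv P i (state R k i) (sent_upto R i k)"
proof (induction k)
  case 0
  show ?case using content_inv_initial[OF initial_state[OF assms]] by simp
next
  case (Suc k)
  from assms show ?case
  proof (cases rule: event_cases[of i k])
    case idle
    then show ?thesis using Suc by simp
  next
    case (active a out)
    show ?thesis
      using content_inv_step[OF Suc pbft_inv_run[OF assms] curr_view_le[OF assms] active(2)]
      unfolding active(3) .
  qed
qed

lemma quiet_before_start:
  assumes "\<forall>k'<k. \<forall>i\<in>correct P. event R k' \<noteq> Step i Start" "i \<in> correct P"
  shows "sent_upto R i k = {} \<and> (\<forall>j\<in>correct P. max_views (state R k i) j = 0) \<and>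
    timer (state R k i) = None \<and> curr_view (state R k i) = 0"
  using assms
proof (induction k arbitrary: i)
  case 0
  then show ?case using initial_state[of i] by (auto simp: initial_def)
next
  case (Suc k)
  have IH: "sent_upto R j k = {}" "\<forall>j'\<in>correct P. max_views (state R k j) j' = 0"
    "timer (state R k j) = None" "curr_view (state R k j) = 0" if "j \<in> correct P" for j
    using Suc.IH[OF _ that] Suc.prems by simp_all
  note i = \<open>i \<in> correct P\<close>
  have voted: "voted (state R k i) = None"
    using pbft_inv.voted_None[OF pbft_inv_run[OF i]] IH(4)[OF i] by simp
  from i show ?case
  proof (cases rule: event_cases[of i k])
    case idle
    then show ?thesis using IH[OF i] by simp
  next
    case (active a out)
    have "a \<noteq> Start" using Suc.prems active(1) by blast
    from active(2) show ?thesis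
    proof (cases rule: step.cases)
      case (receive_wish src v)
      obtain k' where "k' < k" "(src, i, WISH v) \<in> sent R k'"
        using active(5)[OF receive_wish(1)] by blast
      then have "(i, WISH v) \<in> sent_upto R src k" by (auto simp: sent_upto_def)
      then have "src \<notin> correct P" using IH(1) by blast
      define mv where "mv = (max_views (state R k i))(src := max v (max_views (state R k i) src))"
      have mv: "\<forall>j\<in>correct P. mv j = 0"
        using IH(2)[OF i] \<open>src \<notin> correct P\<close> by (auto simp: mv_def)
      have wp: "supported_view P (max_faulty P + 1) mv = 0"
        using supported_correct[of 1 mv] mv by force
      then have w: "supported_view P (2 * max_faulty P + 1) mv = 0"
        using supported_view_antimono[of "max_faulty P + 1" "2 * max_faulty P + 1" P mv] by simp
      from receive_wish(2) show ?thesis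
      proof (cases rule: on_wish_cases)
        case (stay mv' w wp o3)
        then show ?thesis using mv wp w IH[OF i] active(3) by (simp add: mv_def)
      next
        case (enter mv' w wp o3)
        then show ?thesis using w by (simp add: mv_def)
      qed
    next
      case (propose x M)
      then show ?thesis using can_propose_view[of P i "state R k i"] IH(4)[OF i] by blast
    next
      case (vote x)
      then show ?thesis using voted by (simp add: can_vote_def)
    next
      case (lock x C)
      then show ?thesis using voted by (simp add: can_lock_def)
    qed (use \<open>a \<noteq> Start\<close> IH[OF i] active(3) i in \<open>auto\<close>)
  qed
qed

lemma finite_start_times: "finite (start_times P R)"
proof -
  have "start_times P R \<subseteq> (\<lambda>i. time R (THE k. event R k = Step i Start)) ` correct P"
  proof
    fix t assume "t \<in> start_times P R"
    then obtain k i where k: "t = time R k" "i \<in> correct P" "event R k = Step i Start"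
      by (auto simp: start_times_def)
    have "\<exists>!k. event R k = Step i Start" using run k by (auto simp: pbft_fastsync_run_def)
    then have "(THE k. event R k = Step i Start) = k" using k(3) by (rule the1_equality)
    then show "t \<in> (\<lambda>i. time R (THE k. event R k = Step i Start)) ` correct P" using k by auto
  qed
  then show ?thesis using finite_correct by (meson finite_imageI finite_subset)
qed

lemma started_after_gst:
  assumes "i \<in> correct P" "event R k = Step i Start"
  shows "gst P \<le> time R k"
proof -
  have "time R k \<in> start_times P R" using assms by (auto simp: start_times_def)
  then have "S_first P R \<le> time R k" unfolding S_first_def by (rule Min_le[OF finite_start_times])
  then show ?thesis using first_start by simp
qed

lemma active_after_gst:
  assumes "i \<in> correct P" "sent_upto R i (Suc k) \<noteq> {} \<or> curr_view (state R (Suc k) i) \<noteq> 0"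
  shows "gst P \<le> time R k"
proof -
  obtain k' j where "k' < Suc k" "j \<in> correct P" "event R k' = Step j Start"
    using quiet_before_start[of "Suc k" i] assms by blast
  then show ?thesis using started_after_gst[of j k'] time_mono[of k' k] by simp
qed

lemma sent_after_gst:
  assumes "i \<in> correct P" "(i, j, m) \<in> sent R k"
  shows "gst P \<le> time R k"
  using assms by (intro active_after_gst[of i k]) (auto simp: sent_upto_Suc)

lemma entry_after_gst: "i \<in> correct P \<Longrightarrow> entry R i v k \<Longrightarrow> gst P \<le> time R k"
  using active_after_gst[of i k] by (auto simp: entry_def)

lemma delivered:
  assumes "i \<in> correct P" "j \<in> correct P" "(j, m) \<in> sent_upto R i (events_by R t)"
  obtains k where "k < events_by R (t + delta P)" "event R k = Step j (Receive i m)"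
proof -
  obtain k where k: "time R k \<le> t" "(i, j, m) \<in> sent R k"
    using assms(3) by (auto simp: sent_upto_def less_events_by_iff)
  then obtain k' where "event R k' = Step j (Receive i m)" "time R k' \<le> time R k + delta P"
    using run sent_after_gst[OF assms(1) k(2)] assms(1,2)
    unfolding pbft_fastsync_run_def reliable_links_def by blast
  then show thesis using that[of k'] k(1) by (simp add: less_events_by_iff)
qed

section \<open>View synchronization\<close>

lemma max_views_step:
  assumes "i \<in> correct P"
  shows "max_views (state R k i) j \<le> max_views (state R (Suc k) i) j"
  using assms
proof (cases rule: event_cases[of i k])
  case (active a out)
  from active(2) show ?thesis
  proof (cases rule: step.cases)
    case (receive_wish src v)
    from receive_wish(2) show ?thesis
      by (cases rule: on_wish_cases) simp_all
  qed auto
qed simp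

lemma max_views_mono:
  assumes "i \<in> correct P" "k \<le> k'"
  shows "max_views (state R k i) j \<le> max_views (state R k' i) j"
  using max_views_step[OF assms(1)] assms(2)
  by (rule lift_Suc_mono_le)

lemma view_mono: "i \<in> correct P \<Longrightarrow> k \<le> k' \<Longrightarrow> view (state R k i) \<le> view (state R k' i)"
  by (simp only: view_eq) (intro supported_view_mono max_views_mono; simp)

lemma curr_view_step:
  assumes "i \<in> correct P"
  shows "curr_view (state R k i) \<le> curr_view (state R (Suc k) i)"
  using assms
proof (cases rule: event_cases[of i k])
  case (active a out)
  from active(2) show ?thesis
  proof (cases rule: step.cases)
    case (receive_wish src v)
    from receive_wish(2) show ?thesis
      using curr_view_le[OF assms, of k] by (cases rule: on_wish_cases) simp_all
  qed auto
qed simp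

lemma curr_view_mono:
  assumes "i \<in> correct P" "k \<le> k'"
  shows "curr_view (state R k i) \<le> curr_view (state R k' i)"
  using curr_view_step[OF assms(1)] assms(2)
  by (rule lift_Suc_mono_le)

lemma max_views_sent:
  assumes "i \<in> correct P" "max_views (state R k i) j \<noteq> 0"
  shows "(i, WISH (max_views (state R k i) j)) \<in> sent_upto R j k"
  using assms(2)
proof (induction k)
  case 0
  then show ?case using initial_state[OF assms(1)] by (auto simp: initial_def)
next
  case (Suc k)
  have keep: ?case if "max_views (state R (Suc k) i) j = max_views (state R k i) j"
    using that Suc sent_upto_mono[of k "Suc k" R j] by auto
  from assms(1) show ?case
  proof (cases rule: event_cases[of i k])
    case idle
    then show ?thesis using keep by simp
  next
    case (active a out)
    from active(2) show ?thesis
    proof (cases rule: step.cases)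
      case (receive_wish src v)
      have mv: "max_views (state R (Suc k) i) = (max_views (state R k i))(src := max v (max_views (state R k i) src))"
        using receive_wish(2) by (cases rule: on_wish_cases) simp_all
      show ?thesis
      proof (cases "src = j \<and> max_views (state R (Suc k) i) j = v")
        case True
        obtain k' where "k' < k" "(j, i, WISH v) \<in> sent R k'"
          using active(5)[OF receive_wish(1)] True by blast
        then have "k' < Suc k" "(j, i, WISH (max_views (state R (Suc k) i) j)) \<in> sent R k'"
          using True by simp_all
        then show ?thesis unfolding sent_upto_def by blast
      next
        case False
        then show ?thesis by (intro keep) (auto simp: mv max_def split: if_splits)
      qed
    qed (use keep in auto)
  qed
qed

lemma wish_delivered:
  assumes "i \<in> correct P" "j \<in> correct P" "(j, WISH w) \<in> sent_upto R i (events_by R t)"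
  shows "w \<le> max_views (state R (events_by R (t + delta P)) j) i"
proof -
  obtain k where k: "k < events_by R (t + delta P)" "event R k = Step j (Receive i (WISH w))"
    using delivered[OF assms] .
  have "w \<le> max_views (state R (Suc k) j) i"
    using assms(2)
  proof (cases rule: event_cases[of j k])
    case idle
    then show ?thesis using k by blast
  next
    case (active a out)
    then have "a = Receive i (WISH w)" using k by simp
    then have "on_wish P j (time R k) i w (state R k j) = (state R (Suc k) j, out)"
      using active(2) by (auto elim: step.cases)
    then show ?thesis by (cases rule: on_wish_cases) simp_all
  qed
  also have "\<dots> \<le> max_views (state R (events_by R (t + delta P)) j) i"
    using k by (intro max_views_mono assms) simp
  finally show ?thesis .
qed

lemma view_plus_witness:
  assumes "i \<in> correct P" "v < view_plus (state R k i)"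
  obtains j k' w where "j \<in> correct P" "k' < k" "v < w" "(j, i, WISH w) \<in> sent R k'"
proof -
  obtain j where j: "j \<in> correct P" "Suc v \<le> max_views (state R k i) j"
    using supported_correct[of "Suc v"] assms by (auto simp: view_plus_eq Suc_le_eq)
  then have "(i, WISH (max_views (state R k i) j)) \<in> sent_upto R j k"
    by (intro max_views_sent assms) simp
  then show thesis using that j by (auto simp: sent_upto_def Suc_le_eq)
qed

lemma clock_diff:
  assumes "i \<in> correct P" "gst P \<le> s" "s \<le> t"
  shows "clock P i t = clock P i s + (t - s)"
proof -
  have "clock P i t - clock P i s = t - s"
    using sys assms unfolding system_def by blast
  then show ?thesis by simp
qed

lemma timer_state:
  assumes "i \<in> correct P" "curr_view (state R k i) = v" "v \<noteq> 0"
  shows "\<exists>e<k. entry R i v e \<and>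
    (timer (state R k i) = Some (clock P i (time R e) + timeout P v) \<or>
     timer (state R k i) = None \<and> (\<exists>w>v. to_all P (WISH w) \<subseteq> sent_upto R i k) \<and>
       (\<exists>e'<k. time R e + timeout P v \<le> time R e'))"
  using assms(2,3)
proof (induction k)
  case 0
  then show ?case using initial_state[OF assms(1)] by (auto simp: initial_def)
next
  case (Suc k)
  have keep: ?case if same: "curr_view (state R (Suc k) i) = curr_view (state R k i)"
    "timer (state R (Suc k) i) = timer (state R k i)"
  proof -
    obtain e where e: "e < k" "entry R i v e"
      "timer (state R k i) = Some (clock P i (time R e) + timeout P v) \<or>
       timer (state R k i) = None \<and> (\<exists>w>v. to_all P (WISH w) \<subseteq> sent_upto R i k) \<and>
         (\<exists>e'<k. time R e + timeout P v \<le> time R e')"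
      using Suc same by auto
    have "sent_upto R i k \<subseteq> sent_upto R i (Suc k)" by (rule sent_upto_mono) simp
    then show ?thesis
      using e unfolding same by (intro exI[of _ e]) (meson less_SucI order_trans)
  qed
  from assms(1) show ?case
  proof (cases rule: event_cases[of i k])
    case idle
    then show ?thesis by (intro keep) simp_all
  next
    case (active a out)
    from active(2) show ?thesis
    proof (cases rule: step.cases)
      case (timer_expires d)
      then have cv: "curr_view (state R k i) = v" using Suc.prems by simp
      obtain e where e: "e < k" "entry R i v e" "d = clock P i (time R e) + timeout P v"
        using Suc.IH[OF cv] Suc.prems(2) timer_expires by auto
      have "clock P i (time R k) = clock P i (time R e) + (time R k - time R e)"
        using e assms(1) by (intro clock_diff entry_after_gst time_mono) auto
      then have "time R e + timeout P v \<le> time R k" using e timer_expires by linarith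
      moreover have "v < max (view (state R k i) + 1) (view_plus (state R k i))"
        using curr_view_le[OF assms(1), of k] cv by linarith
      ultimately show ?thesis
        using e timer_expires active(3) by (intro exI[of _ e]) auto
    next
      case (receive_wish src v')
      from receive_wish(2) show ?thesis
      proof (cases rule: on_wish_cases)
        case (stay mv w wp o3)
        then show ?thesis by (intro keep) simp_all
      next
        case (enter mv w wp o3)
        then show ?thesis
          using Suc.prems curr_view_le[OF assms(1), of k]
          by (intro exI[of _ k]) (auto simp: entry_def)
      qed
    qed (intro keep; auto)+
  qed
qed

lemma wish_to_all:
  assumes "i \<in> correct P" "(i, j, WISH w) \<in> sent R k" "l \<in> procs P"
  shows "(i, l, WISH w) \<in> sent R k"
  using assms(1)
proof (cases rule: event_cases[of i k])
  case idle
  then show ?thesis using assms by blast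
next
  case (active a out)
  have out: "(j, WISH w) \<in> out" using assms active(4) by blast
  from active(2) have "(l, WISH w) \<in> out"
  proof (cases rule: step.cases)
    case (receive_wish src v)
    from receive_wish(2) show ?thesis
      using out assms(3)
      by (cases rule: on_wish_cases) (auto simp: new_view_outs_def split: if_splits)
  qed (use out assms(3) in \<open>auto split: if_splits\<close>)
  then show ?thesis using active(4) by blast
qed

lemma in_view_entry:
  assumes "i \<in> correct P" "curr_view (state R k i) = v" "v \<noteq> 0"
  obtains e where "e < k" "entry R i v e"
  using timer_state[OF assms] by blast

lemma wish_after_timeout:
  assumes "i \<in> correct P" "(i, j, WISH w) \<in> sent R k" "v < w" "1 \<le> v"
  shows "\<exists>i'\<in>correct P. \<exists>e. entry R i' v e \<and> time R e + timeout P v \<le> time R k"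
  using assms(1-3)
proof (induction k arbitrary: i j w rule: less_induct)
  case (less k)
  note i = \<open>i \<in> correct P\<close>
  show ?case
  proof (cases "\<exists>i0\<in>correct P. \<exists>k0<k. \<exists>j0 w0. (i0, j0, WISH w0) \<in> sent R k0 \<and> v < w0")
    case True
    then obtain i0 k0 j0 w0 where
      0: "i0 \<in> correct P" "k0 < k" "(i0, j0, WISH w0) \<in> sent R k0" "v < w0" by blast
    obtain i' e where "i' \<in> correct P" "entry R i' v e" "time R e + timeout P v \<le> time R k0"
      using less.IH[OF 0(2) 0(1) 0(3) 0(4)] by blast
    then show ?thesis using time_mono[of k0 k] 0(2) by (meson less_imp_le order_trans)
  next
    case False
    have "\<not> v < view_plus (state R k i)"
      using view_plus_witness[OF i, of v k] False by metis
    then have vp: "view_plus (state R k i) \<le> v" by simp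
    have late: ?thesis if "v \<le> view (state R k i)"
      and "timer (state R k i) = None \<or> (\<exists>d. timer (state R k i) = Some d \<and> d \<le> clock P i (time R k))"
    proof -
      have cv: "curr_view (state R k i) = v"
        using that(1) vp view_le[OF i, of k] curr_view_eq[OF i, of k] by simp
      obtain e where e: "e < k" "entry R i v e"
        "timer (state R k i) = Some (clock P i (time R e) + timeout P v) \<or>
         timer (state R k i) = None \<and> (\<exists>e'<k. time R e + timeout P v \<le> time R e')"
        using timer_state[OF i cv] assms(4) by auto
      have "time R e + timeout P v \<le> time R k"
      proof (cases "timer (state R k i)")
        case None
        then obtain e' where "e' < k" "time R e + timeout P v \<le> time R e'" using e by auto
        then show ?thesis using time_mono[of e' k] by simp
      next
        case (Some d)
        have "clock P i (time R k) = clock P i (time R e) + (time R k - time R e)"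
          using e i by (intro clock_diff entry_after_gst time_mono) auto
        then show ?thesis using Some e that(2) by auto
      qed
      then show ?thesis using i e(2) by blast
    qed
    from i show ?thesis
    proof (cases rule: event_cases[of i k])
      case idle
      then show ?thesis using less.prems by blast
    next
      case (active a out)
      have out: "(j, WISH w) \<in> out" using less.prems active(4) by blast
      from active(2) show ?thesis
      proof (cases rule: step.cases)
        case start
        then show ?thesis using out less.prems(3) assms(4) by (auto split: if_splits)
      next
        case (timer_expires d)
        then have "w = max (view (state R k i) + 1) (view_plus (state R k i))" using out by simp
        then have "v \<le> view (state R k i)" using vp \<open>v < w\<close> by linarith
        then show ?thesis using late timer_expires by simp
      next
        case resend
        show ?thesis
        proof (cases "timer (state R k i)")
          case None
          then have "w = max (view (state R k i) + 1) (view_plus (state R k i))"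
            using out resend by (auto split: if_splits)
          then have "v \<le> view (state R k i)" using vp \<open>v < w\<close> by linarith
          then show ?thesis using late None by simp
        next
          case (Some d)
          then have "w = view_plus (state R k i)" using out resend by simp
          then show ?thesis using vp \<open>v < w\<close> by simp
        qed
      next
        case (receive_wish src v')
        define mv where "mv = (max_views (state R k i))(src := max v' (max_views (state R k i) src))"
        have "w = supported_view P (max_faulty P + 1) mv"
          using receive_wish(2) out
          by (cases rule: on_wish_cases)
            (auto simp: mv_def new_view_outs_def split: if_splits)
        then obtain j' where j': "j' \<in> correct P" "w \<le> mv j'"
          using supported_correct[of w mv] \<open>v < w\<close> by auto
        have "\<exists>k0<k. \<exists>w0. (j', i, WISH w0) \<in> sent R k0 \<and> v < w0"
        proof (cases "j' = src \<and> mv j' = v'")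
          case True
          then show ?thesis using active(5)[OF receive_wish(1)] j' \<open>v < w\<close> by (meson less_le_trans)
        next
          case False
          then have "mv j' = max_views (state R k i) j'" by (auto simp: mv_def max_def split: if_splits)
          then have "(i, WISH (mv j')) \<in> sent_upto R j' k"
            using max_views_sent[OF i, of k j'] j' \<open>v < w\<close> by simp
          then show ?thesis using j' \<open>v < w\<close> by (auto simp: sent_upto_def intro: less_le_trans)
        qed
        then show ?thesis using False j' by blast
      qed (use out in auto)
    qed
  qed
qed

abbreviation state_at :: "real \<Rightarrow> pid \<Rightarrow> ('v, 'h) pstate" where
  "state_at t \<equiv> state R (events_by R t)"

definition wished :: "nat \<Rightarrow> real \<Rightarrow> bool" where
  "wished v t \<longleftrightarrow> (\<forall>i\<in>correct P. \<exists>w\<ge>v. to_all P (WISH w) \<subseteq> sent_upto R i (events_by R t))"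

definition entered :: "nat \<Rightarrow> real \<Rightarrow> bool" where
  "entered v t \<longleftrightarrow> (\<forall>i\<in>correct P. \<exists>e<events_by R t. entry R i v e)"

definition first_entry :: "nat \<Rightarrow> nat \<Rightarrow> bool" where
  "first_entry v e \<longleftrightarrow> (\<exists>i\<in>correct P. entry R i v e) \<and>
     (\<forall>e' i. i \<in> correct P \<longrightarrow> entry R i v e' \<longrightarrow> e \<le> e')"

lemma first_entryE:
  assumes "i \<in> correct P" "entry R i v e"
  obtains e0 where "first_entry v e0" "e0 \<le> e"
proof -
  let ?P = "\<lambda>e. \<exists>i\<in>correct P. entry R i v e"
  have ex: "?P e" using assms by blast
  have "first_entry v (LEAST e. ?P e)"
    unfolding first_entry_def using LeastI[of ?P, OF ex] Least_le[of ?P] by blast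
  then show thesis using that Least_le[of ?P, OF ex] by blast
qed

lemma urgent_at:
  assumes "time R 0 \<le> t" "i \<in> correct P"
  shows "\<not> pending P i (state_at t i)"
    and "timer (state_at t i) = Some d \<Longrightarrow> clock P i t < d"
proof -
  obtain k where k: "events_by R t = Suc k"
    using assms(1) less_events_by_iff[of 0 t] by (cases "events_by R t") auto
  have "time R k \<le> t" "t < time R (Suc k)"
    using less_events_by_iff[of k t] less_events_by_iff[of "Suc k" t] k by auto
  moreover have "urgent P R" using run by (simp add: pbft_fastsync_run_def)
  ultimately have "let s = state R (Suc k) i in \<not> pending P i s \<and>
      (\<forall>d. timer s = Some d \<longrightarrow> clock P i t < d) \<and> clock P i t < resend_at s"
    using assms(2) unfolding urgent_def by blast
  then show "\<not> pending P i (state_at t i)" "timer (state_at t i) = Some d \<Longrightarrow> clock P i t < d"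
    unfolding k Let_def by blast+
qed

lemma view_plus_wished:
  assumes "i \<in> correct P" "v \<le> view_plus (state R k i)" "v \<noteq> 0"
  shows "\<exists>w\<ge>v. to_all P (WISH w) \<subseteq> sent_upto R i k"
  using view_plus_sent[OF assms(1), of k] assms(2,3) by auto

lemma wished_view:
  assumes "wished v t" "i \<in> correct P"
  shows "v \<le> view (state_at (t + delta P) i)"
  unfolding view_eq[OF assms(2)]
proof (rule all_correct_supported, rule ballI)
  fix j assume j: "j \<in> correct P"
  obtain w where "v \<le> w" "to_all P (WISH w) \<subseteq> sent_upto R j (events_by R t)"
    using assms(1) j by (auto simp: wished_def)
  then have "(i, WISH w) \<in> sent_upto R j (events_by R t)"
    using assms(2) correct_procs by (auto simp: to_all_subset_iff)
  then have "w \<le> max_views (state_at (t + delta P) i) j"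
    by (rule wish_delivered[OF j assms(2)])
  with \<open>v \<le> w\<close> show "v \<le> max_views (state_at (t + delta P) i) j" by simp
qed

lemma view_plus_before_timeout:
  assumes "first_entry v e" "1 \<le> v" "i \<in> correct P" "t < time R e + timeout P v"
  shows "view_plus (state_at t i) \<le> v"
proof (rule ccontr)
  assume "\<not> ?thesis"
  then have "v < view_plus (state_at t i)" by simp
  with assms(3) obtain j k w where w: "j \<in> correct P" "k < events_by R t" "v < w" "(j, i, WISH w) \<in> sent R k"
    by (rule view_plus_witness)
  obtain i' e' where "i' \<in> correct P" "entry R i' v e'" "time R e' + timeout P v \<le> time R k"
    using wish_after_timeout[OF w(1,4,3) assms(2)] by blast
  then have "time R e + timeout P v \<le> time R k"
    using assms(1) time_mono[of e e'] by (force simp: first_entry_def)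
  then show False using w(2) assms(4) by (simp add: less_events_by_iff)
qed

lemma in_view:
  assumes "i \<in> correct P" "v \<le> view (state R k i)" "view_plus (state R k i) \<le> v"
  shows "curr_view (state R k i) = v"
  using curr_view_eq[OF assms(1), of k] view_le[OF assms(1), of k] assms(2,3) by simp

lemma bounded_entry:
  assumes "first_entry v e" "1 \<le> v" "i \<in> correct P"
    and "time R e + 2 * delta P \<le> t" "t < time R e + timeout P v"
  shows "curr_view (state_at t i) = v"
proof -
  obtain i0 where i0: "i0 \<in> correct P" "entry R i0 v e"
    using assms(1) by (auto simp: first_entry_def)
  have "v \<le> view (state R (Suc e) i0)"
    using curr_view_le[OF i0(1), of "Suc e"] i0(2) by (simp add: entry_def)
  also have "\<dots> \<le> view (state_at (time R e) i0)"
    using less_events_by_iff[of e "time R e"] by (intro view_mono i0) simp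
  finally have i0_view: "v \<le> supported_view P (2 * max_faulty P + 1) (max_views (state_at (time R e) i0))"
    by (simp only: view_eq[OF i0(1)])
  have vp: "v \<le> view_plus (state_at (time R e + delta P) j)" if j: "j \<in> correct P" for j
    unfolding view_plus_eq[OF j] using i0_view
  proof (rule supported_transfer)
    fix l assume l: "l \<in> correct P" "v \<le> max_views (state_at (time R e) i0) l"
    then obtain k where k: "k < events_by R (time R e)"
        "(l, i0, WISH (max_views (state_at (time R e) i0) l)) \<in> sent R k"
      using max_views_sent[OF i0(1), of "events_by R (time R e)" l] assms(2) by (auto simp: sent_upto_def)
    define w where "w = max_views (state_at (time R e) i0) l"
    have "(j, WISH w) \<in> sent_upto R l (events_by R (time R e))"
      using wish_to_all[OF l(1), of i0 w k j] k j correct_procs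
      by (auto simp: sent_upto_def w_def)
    then have "w \<le> max_views (state_at (time R e + delta P) j) l"
      by (rule wish_delivered[OF l(1) j])
    then show "v \<le> max_views (state_at (time R e + delta P) j) l"
      using l by (simp add: w_def)
  qed
  have "wished v (time R e + delta P)"
    unfolding wished_def using view_plus_wished vp assms(2) by simp
  from wished_view[OF this assms(3)] have "v \<le> view (state_at (time R e + 2 * delta P) i)"
    by (simp add: algebra_simps)
  also have "\<dots> \<le> view (state_at t i)"
    using assms by (intro view_mono events_by_mono)
  finally show ?thesis
    using view_plus_before_timeout[OF assms(1-3,5)] by (intro in_view assms(3))
qed

lemma timeout_bound: "1 \<le> v \<Longrightarrow> 6 * delta P < timeout P v"
  using timeout_1 timeout_ge by fastforce

lemma enteredI:
  assumes "1 \<le> v" "\<And>i. i \<in> correct P \<Longrightarrow> \<exists>t'\<le>t. curr_view (state_at t' i) = v"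
  shows "entered v t"
  unfolding entered_def
proof
  fix i assume i: "i \<in> correct P"
  then obtain t' where "t' \<le> t" "curr_view (state_at t' i) = v" using assms(2) by blast
  then show "\<exists>e<events_by R t. entry R i v e"
    using in_view_entry[OF i] events_by_mono[of t' t] assms(1) by (metis not_one_le_zero order_less_le_trans)
qed

lemma wished_entered:
  assumes "wished v t" "1 \<le> v"
  shows "entered v (t + delta P)"
proof (cases "\<exists>i\<in>correct P. v < view_plus (state_at (t + delta P) i)")
  case True
  then obtain i where "i \<in> correct P" "v < view_plus (state_at (t + delta P) i)" by blast
  then obtain j k w where j: "j \<in> correct P" "k < events_by R (t + delta P)" "v < w" "(j, i, WISH w) \<in> sent R k"
    by (rule view_plus_witness)
  obtain i' e' where "i' \<in> correct P" "entry R i' v e'" "time R e' + timeout P v \<le> time R k"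
    using wish_after_timeout[OF j(1,4,3) assms(2)] by blast
  moreover then obtain e where e: "first_entry v e" "e \<le> e'" by (meson first_entryE)
  ultimately have "time R e + timeout P v \<le> t + delta P"
    using time_mono[of e e'] j(2) by (simp add: less_events_by_iff)
  then show ?thesis
    using timeout_bound[OF assms(2)] delta_nonneg bounded_entry[OF e(1) assms(2)]
    by (intro enteredI[OF assms(2)] exI[of _ "time R e + 2 * delta P"]) simp
next
  case False
  then show ?thesis
    using wished_view[OF assms(1)] in_view[of _ v "events_by R (t + delta P)"]
    by (intro enteredI[OF assms(2)] exI[of _ "t + delta P"]) (simp add: not_less)
qed

lemma entered_wished:
  assumes "entered v t" "1 \<le> v"
  shows "wished (v + 1) (t + timeout P v)"
  unfolding wished_def
proof
  fix i assume i: "i \<in> correct P"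
  let ?t = "t + timeout P v"
  obtain e where e: "e < events_by R t" "entry R i v e"
    using assms(1) i by (auto simp: entered_def)
  have "0 \<le> timeout P v" using timeout_bound[OF assms(2)] delta_nonneg by simp
  then have "Suc e \<le> events_by R ?t"
    using e(1) events_by_mono[of t ?t] by simp
  then have ge: "v \<le> curr_view (state_at ?t i)"
    using curr_view_mono[OF i, of "Suc e"] e(2) by (simp add: entry_def)
  show "\<exists>w\<ge>v + 1. to_all P (WISH w) \<subseteq> sent_upto R i (events_by R ?t)"
  proof (cases "curr_view (state_at ?t i) = v")
    case False
    then have "v + 1 \<le> view_plus (state_at ?t i)"
      using ge curr_view_le[OF i, of "events_by R ?t"] view_le[OF i, of "events_by R ?t"] by simp
    then show ?thesis by (intro view_plus_wished i) simp_all
  next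
    case True
    obtain e' where e': "entry R i v e'"
      "timer (state_at ?t i) = Some (clock P i (time R e') + timeout P v) \<or>
       (\<exists>w>v. to_all P (WISH w) \<subseteq> sent_upto R i (events_by R ?t))"
      using timer_state[OF i True] assms(2) by auto
    have "e' \<le> e"
      using curr_view_mono[OF i, of "Suc e" e'] e(2) e'(1) by (force simp: entry_def)
    then have le: "time R e' \<le> t"
      using e(1) time_mono[of e' e] by (simp add: less_events_by_iff)
    have "clock P i ?t = clock P i (time R e') + (?t - time R e')"
      using le \<open>0 \<le> timeout P v\<close> by (intro clock_diff i entry_after_gst[OF i e'(1)]) simp
    moreover have "time R 0 \<le> ?t"
      using le \<open>0 \<le> timeout P v\<close> time_mono[of 0 e'] by simp
    ultimately have "timer (state_at ?t i) \<noteq> Some (clock P i (time R e') + timeout P v)"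
      using urgent_at(2)[OF _ i, of ?t] le by force
    then show ?thesis using e'(2) by (metis Suc_eq_plus1 Suc_leI)
  qed
qed

lemma wished_start: "wished 1 (S_last P R)"
  unfolding wished_def
proof
  fix i assume i: "i \<in> correct P"
  obtain k where k: "event R k = Step i Start"
    using run i unfolding pbft_fastsync_run_def by blast
  have "time R k \<in> start_times P R" using k i by (auto simp: start_times_def)
  then have "time R k \<le> S_last P R"
    unfolding S_last_def using finite_start_times by (intro Max_ge)
  then have le: "Suc k \<le> events_by R (S_last P R)" by (simp add: less_events_by_iff Suc_le_eq)
  have "\<exists>w\<ge>1. to_all P (WISH w) \<subseteq> sent_upto R i (Suc k)"
    using i
  proof (cases rule: event_cases[of i k])
    case idle
    then show ?thesis using k by blast
  next
    case (active a out)
    then have "step P i (time R k) Start (state R k i) (state R (Suc k) i) out" using k by simp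
    then have s: "state R (Suc k) i = state R k i"
      "out = (if view_plus (state R k i) = 0 then to_all P (WISH 1) else {})"
      by (auto elim: step.cases)
    show ?thesis
    proof (cases "view_plus (state R k i) = 0")
      case True
      then show ?thesis using s active(3) by (intro exI[of _ 1]) simp
    next
      case False
      then show ?thesis using s by (intro view_plus_wished i) simp_all
    qed
  qed
  then show "\<exists>w\<ge>1. to_all P (WISH w) \<subseteq> sent_upto R i (events_by R (S_last P R))"
    using sent_upto_mono[OF le] by blast
qed

lemma entered_by:
  assumes "1 \<le> v"
  shows "entered v (S_last P R + (\<Sum>k=1..<v. timeout P k + delta P) + delta P)"
  using assms
proof (induction v rule: dec_induct)
  case base
  then show ?case using wished_entered[OF wished_start] by simp
next
  case (step v)
  show ?case
    using wished_entered[OF entered_wished[OF step.IH step.hyps(1)]] step.hyps(1)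
    by (simp add: algebra_simps)
qed

end

section \<open>Authenticity and delivery\<close>

lemma parts_step:
  assumes step: "step P i now a s s' out"
    and recv: "\<forall>m\<in>received s. signed_parts (PBFT m) \<subseteq> G"
    and cert: "\<forall>C. cert s = Some C \<longrightarrow> PREPARED ` C \<subseteq> G"
    and receive: "\<forall>src m. a = Receive src m \<longrightarrow> signed_parts m \<subseteq> G"
    and own: "\<forall>d m. (d, PBFT m) \<in> out \<longrightarrow> m \<in> G"
  shows "(\<forall>m\<in>received s'. signed_parts (PBFT m) \<subseteq> G) \<and>
    (\<forall>C. cert s' = Some C \<longrightarrow> PREPARED ` C \<subseteq> G) \<and> (\<forall>(d, m)\<in>out. signed_parts m \<subseteq> G)"
  using step
proof (cases rule: step.cases)
  case (receive_wish src v)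
  from receive_wish(2) show ?thesis
  proof (cases rule: on_wish_cases)
    case (stay mv w wp o3)
    then show ?thesis using recv cert by auto
  next
    case (enter mv w wp o3)
    have "signed_parts m \<subseteq> G" if "(d, m) \<in> out" for d m
    proof (cases m)
      case (PBFT m')
      then have "m' \<in> G" using that own by blast
      have "(d, PBFT m') \<in> new_view_outs P i w s"
        using that PBFT unfolding enter(4,8) by (auto split: if_splits)
      with \<open>m' \<in> G\<close> show ?thesis
        using cert PBFT unfolding new_view_outs_def by (auto split: if_splits option.splits)
    qed simp
    then show ?thesis using recv cert unfolding enter(7) by auto
  qed
next
  case (receive_pbft src m)
  then have "signed_parts (PBFT m) \<subseteq> G" using receive by blast
  moreover have "received s' \<subseteq> insert m (received s)" using receive_pbft by (auto simp: store_def)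
  ultimately show ?thesis using recv cert receive_pbft by auto
next
  case (propose x M)
  have "PROPOSE (curr_view s) x M i \<in> G"
    using own leader_in_procs unfolding propose(3) by (metis to_all_iff)
  moreover have "newleader_parts m \<subseteq> G" if "m \<in> M" for m
  proof -
    have "NEWLEADER m \<in> received s" using propose(4) that unfolding can_propose_def by blast
    then show ?thesis using recv by fastforce
  qed
  ultimately have "signed_parts (PBFT (PROPOSE (curr_view s) x M i)) \<subseteq> G"
    by (simp add: UN_subset_iff)
  then show ?thesis
    using recv cert unfolding propose(2,3) by (auto simp del: signed_parts.simps)
next
  case (lock x C)
  have "PREPARED ` C \<subseteq> G" using lock(4) recv by (fastforce simp: can_lock_def)
  then show ?thesis using recv own unfolding lock(2,3) by auto
next
  case (vote x)
  then show ?thesis using recv cert own by auto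
next
  case (resend)
  then show ?thesis using recv cert by auto
next
  case start
  then show ?thesis using recv cert by auto
qed (use recv cert in auto)

lemma store_self:
  assumes "curr_view s \<le> msg_view m"
    and "\<And>m'. m' \<in> received s \<Longrightarrow> same_slot m m' \<Longrightarrow> msg_view m \<le> msg_view m' \<Longrightarrow> m' = m"
  shows "m \<in> received (store m s)"
  using assms unfolding store_def by auto

lemma step_received:
  assumes "step P i now a s s' out" "m \<in> received s"
    and "\<And>src m'. a = Receive src (PBFT m') \<Longrightarrow> same_slot m' m \<Longrightarrow> msg_view m' \<le> msg_view m"
  shows "m \<in> received s'"
  using assms(1)
proof (cases rule: step.cases)
  case (receive_wish src v)
  from receive_wish(2) show ?thesis
    by (cases rule: on_wish_cases) (use assms(2) in simp_all)
next
  case (receive_pbft src m')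
  then show ?thesis using assms(2,3) unfolding receive_pbft(2) store_def by auto
qed (use assms(2) in auto)

context synchronous_run
begin

definition genuine :: "nat \<Rightarrow> ('v, 'h) pbft_msg set" where
  "genuine k = {u. signer u \<in> correct P \<longrightarrow> (\<exists>d. (d, PBFT u) \<in> sent_upto R (signer u) k)}"

lemma genuine_mono: "k \<le> k' \<Longrightarrow> genuine k \<subseteq> genuine k'"
  using sent_upto_mono unfolding genuine_def by blast

lemma authentic:
  "(\<forall>k'<k. \<forall>(src, d, m)\<in>sent R k'. signed_parts m \<subseteq> genuine k) \<and>
   (\<forall>i\<in>correct P. (\<forall>m\<in>received (state R k i). signed_parts (PBFT m) \<subseteq> genuine k) \<and>
     (\<forall>C. cert (state R k i) = Some C \<longrightarrow> PREPARED ` C \<subseteq> genuine k))"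
proof (induction k)
  case 0
  have "received (state R 0 i) = {}" "cert (state R 0 i) = None" if "i \<in> correct P" for i
    using initial_state[OF that] by (auto simp: initial_def)
  then show ?case by simp
next
  case (Suc k)
  have mono: "genuine k \<subseteq> genuine (Suc k)" by (rule genuine_mono) simp
  have sent_old: "signed_parts m \<subseteq> genuine (Suc k)" if "k' < k" "(src, d, m) \<in> sent R k'" for k' src d m
    using Suc.IH that mono by fastforce
  have recv_old: "\<forall>m\<in>received (state R k i). signed_parts (PBFT m) \<subseteq> genuine (Suc k)"
    and cert_old: "\<forall>C. cert (state R k i) = Some C \<longrightarrow> PREPARED ` C \<subseteq> genuine (Suc k)"
    if "i \<in> correct P" for i
    using Suc.IH that mono by (meson order_trans)+
  have new: "(\<forall>m\<in>received (state R (Suc k) i). signed_parts (PBFT m) \<subseteq> genuine (Suc k)) \<and>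
      (\<forall>C. cert (state R (Suc k) i) = Some C \<longrightarrow> PREPARED ` C \<subseteq> genuine (Suc k)) \<and>
      (\<forall>d m. (i, d, m) \<in> sent R k \<longrightarrow> signed_parts m \<subseteq> genuine (Suc k))"
    if i: "i \<in> correct P" for i
    using i
  proof (cases rule: event_cases[of i k])
    case idle
    then show ?thesis using recv_old[OF i] cert_old[OF i] by simp
  next
    case (active a out)
    have own: "\<forall>d m. (d, PBFT m) \<in> out \<longrightarrow> m \<in> genuine (Suc k)"
    proof (intro allI impI)
      fix d m assume "(d, PBFT m) \<in> out"
      then have "(d, PBFT m) \<in> sent_upto R i (Suc k)" using active(3) by blast
      moreover from this have "signer m = i" using pbft_inv.sent[OF pbft_inv_run[OF i]] by blast
      ultimately show "m \<in> genuine (Suc k)" by (auto simp: genuine_def)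
    qed
    have receive: "\<forall>src m. a = Receive src m \<longrightarrow> signed_parts m \<subseteq> genuine (Suc k)"
      using active(5) sent_old by blast
    show ?thesis
      using parts_step[OF active(2) recv_old[OF i] cert_old[OF i] receive own] active(4) by fast
  qed
  have "signed_parts m \<subseteq> genuine (Suc k)" if s: "(src, d, m) \<in> sent R k" for src d m
  proof (cases "event R k")
    case (Step i a)
    then have "correct_step P R k i a" using event_run[of k] by simp
    then have "src \<in> correct P" using s by (auto simp: correct_step_def)
    then show ?thesis using new s by blast
  next
    case Adversary
    then have "adversary_step P R k" using event_run[of k] by simp
    then have *: "\<forall>u\<in>signed_parts m. signer u \<in> correct P \<longrightarrow>
        (\<exists>k'<k. \<exists>dst'. (signer u, dst', PBFT u) \<in> sent R k')"
      using s by (fastforce simp: adversary_step_def)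
    show ?thesis
    proof
      fix u assume "u \<in> signed_parts m"
      with * have "u \<in> genuine k" unfolding genuine_def sent_upto_def by blast
      then show "u \<in> genuine (Suc k)" using mono by blast
    qed
  qed
  then have "\<forall>k'<Suc k. \<forall>(src, d, m)\<in>sent R k'. signed_parts m \<subseteq> genuine (Suc k)"
    using sent_old unfolding less_Suc_eq by blast
  then show ?case using new by blast
qed

lemma self_part: "m \<in> signed_parts (PBFT m)"
proof (cases m)
  case (NEWLEADER n)
  then show ?thesis by (cases n) simp
qed auto

lemma received_genuine:
  assumes "i \<in> correct P" "m \<in> received (state R k i)" "signer m \<in> correct P"
  obtains d where "(d, PBFT m) \<in> sent_upto R (signer m) k"
proof -
  have "m \<in> genuine k" using authentic[of k] assms(1,2) self_part[of m] by blast
  then show thesis using that assms(3) by (auto simp: genuine_def)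
qed

text \<open>
  A buffered message of a correct process gives way only to one that this process has sent in a
  higher view.
\<close>

lemma message_kept:
  assumes i: "i \<in> correct P" and j: "signer m \<in> correct P"
    and rcv: "event R k0 = Step i (Receive src (PBFT m))" and "k0 < k"
    and views: "\<forall>l\<in>correct P. curr_view (state R k l) \<le> msg_view m"
  shows "m \<in> received (state R k i)"
proof -
  obtain k1 where k1: "k1 < k0" "(src, i, PBFT m) \<in> sent R k1"
    and rcv_step: "step P i (time R k0) (Receive src (PBFT m)) (state R k0 i) (state R (Suc k0) i) {}"
    using i
  proof (cases rule: event_cases[of i k0])
    case idle
    then show ?thesis using rcv by blast
  next
    case (active a out)
    then have a: "a = Receive src (PBFT m)" using rcv by simp
    then have "out = {}" using active(2) by (auto elim: step.cases)
    then show ?thesis using that active(2,5) a by blast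
  qed
  have recent: "msg_view m' \<le> msg_view m \<and> (msg_view m' = msg_view m \<longrightarrow> m' = m)"
    if k': "k0 \<le> k'" "k' \<le> k" and slot: "same_slot m' m" and m': "m' \<in> genuine k'" for k' m'
  proof -
    have sj: "signer m' = signer m" using slot by (simp add: same_slot_def)
    obtain d' where d': "(d', PBFT m') \<in> sent_upto R (signer m) k'"
      using j m' by (auto simp: genuine_def sj)
    have le: "msg_view m' \<le> msg_view m"
      using pbft_inv.sent[OF pbft_inv_run[OF j] d'] curr_view_mono[OF j k'(2)] views j
      by (meson order_trans)
    have "m \<in> genuine k0"
      using authentic[of k0] k1 self_part[of m] by fast
    then have "m \<in> genuine k'" using genuine_mono[OF k'(1)] by blast
    then obtain d'' where "(d'', PBFT m) \<in> sent_upto R (signer m) k'"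
      using j by (auto simp: genuine_def)
    then show ?thesis
      using le d' pbft_inv.unique[OF pbft_inv_run[OF j]] slot unfolding unique_slots_def by blast
  qed
  have "k' \<le> k \<longrightarrow> m \<in> received (state R k' i)" if "Suc k0 \<le> k'" for k'
    using that
  proof (induction k' rule: dec_induct)
    case base
    have st: "state R (Suc k0) i = store m (state R k0 i)"
      using rcv_step by (auto elim: step.cases)
    have "curr_view (state R k0 i) \<le> msg_view m"
      using curr_view_mono[OF i, of k0 k] views i \<open>k0 < k\<close> by fastforce
    moreover have "m' = m" if "m' \<in> received (state R k0 i)" "same_slot m m'" "msg_view m \<le> msg_view m'" for m'
    proof -
      have "m' \<in> genuine k0" using authentic[of k0] i that(1) self_part[of m'] by blast
      then show ?thesis using recent[of k0 m'] that \<open>k0 < k\<close> same_slot_sym by fastforce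
    qed
    ultimately show ?case unfolding st by (simp add: store_self)
  next
    case (step k')
    show ?case
    proof
      assume k: "Suc k' \<le> k"
      then have m: "m \<in> received (state R k' i)" using step by simp
      from i show "m \<in> received (state R (Suc k') i)"
      proof (cases rule: event_cases[of i k'])
        case idle
        then show ?thesis using m by simp
      next
        case (active a out)
        have "msg_view m' \<le> msg_view m" if "a = Receive src' (PBFT m')" "same_slot m' m" for src' m'
        proof -
          have "m' \<in> genuine k'"
            using active(5)[OF that(1)] authentic[of k'] self_part[of m'] by fast
          then show ?thesis using recent[of k' m'] step.hyps k that(2) by simp
        qed
        then show ?thesis using step_received[OF active(2) m] by blast
      qed
    qed
  qed
  then show ?thesis using \<open>k0 < k\<close> by simp
qed

lemma message_received:
  assumes i: "i \<in> correct P" and j: "j \<in> correct P"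
    and m: "(i, PBFT m) \<in> sent_upto R j (events_by R t)" and t': "t + delta P \<le> t'"
    and views: "\<forall>l\<in>correct P. curr_view (state R (events_by R t') l) \<le> msg_view m"
  shows "m \<in> received (state R (events_by R t') i)"
proof -
  obtain k where k: "k < events_by R (t + delta P)" "event R k = Step i (Receive j (PBFT m))"
    using delivered[OF j i m] .
  have "signer m = j" using pbft_inv.sent[OF pbft_inv_run[OF j] m] by blast
  moreover have "k < events_by R t'" using k(1) events_by_mono[OF t'] by simp
  ultimately show ?thesis using message_kept[OF i _ k(2) _ views] j by simp
qed

lemma decided_event:
  assumes "i \<in> correct P" "decided (state R k i) \<noteq> None"
  shows "\<exists>k'<k. \<exists>x. event R k' = Step i (Decide x)"
  using assms(2)
proof (induction k)
  case 0
  then show ?case using initial_state[OF assms(1)] by (auto simp: initial_def)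
next
  case (Suc k)
  have keep: ?case if "decided (state R (Suc k) i) = decided (state R k i)"
    using that Suc less_SucI by metis
  from assms(1) show ?case
  proof (cases rule: event_cases[of i k])
    case idle
    then show ?thesis using keep by simp
  next
    case (active a out)
    from active(2) show ?thesis
    proof (cases rule: step.cases)
      case (receive_wish src v)
      from receive_wish(2) show ?thesis
        by (cases rule: on_wish_cases) (use keep in simp_all)
    next
      case (decide x)
      then show ?thesis using active(1) by blast
    qed (use keep in auto)
  qed
qed

end

section \<open>Deciding in a view with a correct leader\<close>

locale good_view = synchronous_run +
  fixes v :: nat and L :: real
  assumes leader_correct: "leader P v \<in> correct P" and view_pos: "1 \<le> v"
    and stays: "L \<le> t \<Longrightarrow> t \<le> L + 4 * delta P \<Longrightarrow> i \<in> correct P \<Longrightarrow> curr_view (state_at t i) = v"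
begin

lemma not_pending:
  assumes "L \<le> t" "t \<le> L + 4 * delta P" "i \<in> correct P"
  shows "\<not> pending P i (state_at t i)"
proof (rule urgent_at(1)[OF _ assms(3)])
  have "events_by R t \<noteq> 0"
  proof
    assume "events_by R t = 0"
    then have "curr_view (state_at t i) = 0"
      using initial_state[OF assms(3)] by (auto simp: initial_def)
    then show False using stays[OF assms] view_pos by simp
  qed
  then show "time R 0 \<le> t" using less_events_by_iff[of 0 t] by simp
qed

lemma message_in_view:
  assumes "i \<in> correct P" "j \<in> correct P" "(i, PBFT m) \<in> sent_upto R j (events_by R t)"
    and "msg_view m = v" "L \<le> t" "t + delta P \<le> t'" "t' \<le> L + 4 * delta P"
  shows "m \<in> received (state_at t' i)"
  by (rule message_received[OF assms(1-3) assms(6)])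
    (use stays[of t'] assms delta_nonneg in simp)

lemma correct_quorum: obtains Q where "quorum P Q" "Q \<subseteq> correct P"
  using obtain_subset_with_card_n[OF card_correct] correct_procs that
  unfolding quorum_def by (metis order_trans)

lemma quorum_has_correct:
  assumes "quorum P Q"
  obtains j where "j \<in> Q" "j \<in> correct P"
proof -
  have "\<not> Q \<subseteq> faulty P"
    using assms card_mono[OF finite_faulty, of Q] card_faulty unfolding quorum_def by fastforce
  then show thesis using assms that unfolding quorum_def faulty_def by blast
qed

lemma leader_proposed:
  obtains x M where
    "to_all P (PBFT (PROPOSE v x M (leader P v))) \<subseteq> sent_upto R (leader P v) (events_by R (L + delta P))"
proof -
  let ?l = "leader P v" and ?k = "events_by R (L + delta P)"
  define s where "s = state_at (L + delta P) (leader P v)"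
  have cv: "curr_view s = v"
    unfolding s_def using stays[of "L + delta P" ?l] leader_correct delta_nonneg by simp
  have "proposed s"
  proof (cases "v = 1")
    case True
    then show ?thesis
      using content_inv.first_proposed[OF content_inv_run[OF leader_correct], of ?k] cv
      unfolding s_def by simp
  next
    case False
    then have v2: "2 \<le> v" using view_pos by simp
    obtain Q where Q: "quorum P Q" "Q \<subseteq> correct P" by (rule correct_quorum)
    have "\<exists>w y C. NEWLEADER (NewLeader v w y C j) \<in> received s \<and>
        valid_new_leader P (NewLeader v w y C j)" if jc: "j \<in> correct P" for j
    proof -
      have "curr_view (state_at L j) = v" using stays jc delta_nonneg by simp
      then obtain w y C where
        m: "(?l, PBFT (NEWLEADER (NewLeader v w y C j))) \<in> sent_upto R j (events_by R L)"
        using content_inv.newleader_sent[OF content_inv_run[OF jc], of "events_by R L"] v2 by auto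
      have "NEWLEADER (NewLeader v w y C j) \<in> received s"
        unfolding s_def
        by (rule message_in_view[OF leader_correct jc m]) (use delta_nonneg in simp_all)
      moreover have "valid_new_leader P (NewLeader v w y C j)"
        using content_inv.newleader_valid[OF content_inv_run[OF jc] m] .
      ultimately show ?thesis by blast
    qed
    then have "\<forall>j\<in>Q. \<exists>w y C. NEWLEADER (NewLeader v w y C j) \<in> received s \<and>
        valid_new_leader P (NewLeader v w y C j)" using Q(2) by blast
    then obtain vw vl ct where *: "\<forall>j\<in>Q. NEWLEADER (NewLeader v (vw j) (vl j) (ct j) j) \<in> received s \<and>
        valid_new_leader P (NewLeader v (vw j) (vl j) (ct j) j)"
      unfolding bchoice_iff by blast
    define M where "M = (\<lambda>j. NewLeader v (vw j) (vl j) (ct j) j) ` Q"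
    have M: "NEWLEADER ` M \<subseteq> received s" "\<forall>m\<in>M. valid_new_leader P m"
      using * unfolding M_def by blast+
    have "\<exists>x. if Max (vw ` Q) \<noteq> 0 then \<exists>j\<in>Q. vw j = Max (vw ` Q) \<and> vl j = Some x else x = myval P ?l"
    proof (cases "Max (vw ` Q) = 0")
      case False
      have "finite Q" "Q \<noteq> {}"
        using Q(2) finite_correct quorum_nonempty[OF Q(1)] finite_subset by blast+
      then have "Max (vw ` Q) \<in> vw ` Q" by (intro Max_in) auto
      then obtain j where j: "j \<in> Q" "vw j = Max (vw ` Q)" by auto
      then have "\<exists>y. vl j = Some y" using * False by auto
      then show ?thesis using False j by auto
    qed simp
    then obtain x where
      x: "if Max (vw ` Q) \<noteq> 0 then \<exists>j\<in>Q. vw j = Max (vw ` Q) \<and> vl j = Some x else x = myval P ?l" ..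
    have "\<not> pending P ?l s"
      unfolding s_def using delta_nonneg by (intro not_pending leader_correct) simp_all
    then have "\<not> can_propose P ?l s x M" unfolding pending_def by blast
    moreover have "can_propose P ?l s x M" if "\<not> proposed s"
      unfolding can_propose_def cv
      by (intro conjI exI[of _ Q] exI[of _ vw] exI[of _ vl] exI[of _ ct])
        (fact False, rule refl, fact that, fact Q, fact M_def, fact M, fact M, fact x)
    ultimately show ?thesis by blast
  qed
  then show thesis
    using pbft_inv.proposed_sent[OF pbft_inv_run[OF leader_correct], of ?k] cv that
    unfolding s_def by auto
qed

lemma proposal_safe:
  assumes "(d, PBFT (PROPOSE v x M (leader P v))) \<in> sent_upto R (leader P v) k"
  shows "safe_proposal P v x M (leader P v)"
proof (cases "v = 1")
  case True
  then have "x = myval P (leader P v)"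
    using content_inv.proposal_justified[OF content_inv_run[OF leader_correct] assms]
    by (simp add: justified_def)
  then show ?thesis using True sys leader_correct by (auto simp: safe_proposal_def system_def)
next
  case False
  let ?l = "leader P v"
  have just: "justified P v x M ?l"
    using content_inv.proposal_justified[OF content_inv_run[OF leader_correct] assms] .
  obtain Q vw vl ct where Q: "quorum P Q" "M = (\<lambda>j. NewLeader v (vw j) (vl j) (ct j) j) ` Q"
      "\<forall>m\<in>M. valid_new_leader P m"
    and x: "if Max (vw ` Q) \<noteq> 0 then \<exists>j\<in>Q. vw j = Max (vw ` Q) \<and> vl j = Some x
        else x = myval P ?l"
    using just False unfolding justified_def by auto
  have fin: "finite Q" using Q(1) finite_subset[of Q "procs P"] by (simp add: quorum_def)
  have valid: "valid P x"
  proof (cases "Max (vw ` Q) = 0")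
    case True
    then show ?thesis using x sys leader_correct by (auto simp: system_def)
  next
    case nz: False
    then obtain j where j: "j \<in> Q" "vw j \<noteq> 0" "vl j = Some x" using x by auto
    then have "valid_new_leader P (NewLeader v (vw j) (vl j) (ct j) j)" using Q by blast
    then obtain C where C: "ct j = Some C" "prepared P C (vw j) (hash P x)" using j by auto
    then obtain Q' where Q': "quorum P Q'" "C = (\<lambda>j'. Prepared (vw j) (hash P x) j') ` Q'"
      by (auto simp: prepared_def)
    obtain q where q: "q \<in> Q'" "q \<in> correct P" using quorum_has_correct[OF Q'(1)] .
    let ?u = "PREPARED (Prepared (vw j) (hash P x) q)"
    have "?u \<in> newleader_parts (NewLeader v (vw j) (vl j) (ct j) j)"
      using C(1) Q'(2) q(1) by auto
    then have "?u \<in> signed_parts (PBFT (PROPOSE v x M ?l))"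
      using Q(2) j(1) by auto
    moreover obtain k' where "k' < k" "(?l, d, PBFT (PROPOSE v x M ?l)) \<in> sent R k'"
      using assms by (auto simp: sent_upto_def)
    ultimately have "?u \<in> genuine k" using authentic[of k] by fast
    then obtain d' where "(d', PBFT ?u) \<in> sent_upto R q k"
      using q by (auto simp: genuine_def)
    then obtain y where "hash P x = hash P y" "valid P y"
      using content_inv.prepared_valid[OF content_inv_run[OF q(2)]] by blast
    then show ?thesis using sys by (auto simp: system_def dest: injD)
  qed
  have "(\<exists>j\<in>Q. vw j \<noteq> 0) \<longrightarrow> (\<exists>j\<in>Q. vw j = Max (vw ` Q) \<and> vl j = Some x)"
  proof
    assume "\<exists>j\<in>Q. vw j \<noteq> 0"
    then have "Max (vw ` Q) \<noteq> 0" using fin Max_ge[of "vw ` Q"] by (metis finite_imageI imageI le_zero_eq)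
    then show "\<exists>j\<in>Q. vw j = Max (vw ` Q) \<and> vl j = Some x" using x by simp
  qed
  then show ?thesis
    unfolding safe_proposal_def using valid Q by blast
qed

lemma all_decide:
  assumes i: "i \<in> correct P"
  shows "decides_by R i (L + 4 * delta P)"
proof -
  let ?l = "leader P v"
  note d0 = delta_nonneg
  obtain x M where proposal:
    "to_all P (PBFT (PROPOSE v x M ?l)) \<subseteq> sent_upto R ?l (events_by R (L + delta P))"
    by (rule leader_proposed)
  have voted: "voted (state_at t j) = Some True \<and> curr_val (state_at t j) = Some x \<and>
      to_all P (PBFT (PREPARED (Prepared v (hash P x) j))) \<subseteq> sent_upto R j (events_by R t)"
    if t: "L + 2 * delta P \<le> t" "t \<le> L + 4 * delta P" and j: "j \<in> correct P" for t j
  proof -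
    let ?s = "state_at t j"
    have m: "(j, PBFT (PROPOSE v x M ?l)) \<in> sent_upto R ?l (events_by R (L + delta P))"
      using proposal j correct_procs by (auto simp: to_all_subset_iff)
    have "PROPOSE v x M ?l \<in> received ?s"
      by (rule message_in_view[OF j leader_correct m]) (use d0 t in simp_all)
    moreover have cv: "curr_view ?s = v" using stays[of t j] t j d0 by simp
    moreover have "\<not> pending P j ?s" using t d0 by (intro not_pending j) simp_all
    ultimately have "voted ?s \<noteq> Some False"
      using proposal_safe[OF m] unfolding pending_def can_vote_def by metis
    moreover have "voted ?s \<noteq> None"
      using pbft_inv.voted_None[OF pbft_inv_run[OF j]] cv view_pos by simp
    ultimately have vt: "voted ?s = Some True" by auto
    then obtain y M' j' where y: "curr_val ?s = Some y"
      "to_all P (PBFT (PREPARED (Prepared v (hash P y) j))) \<subseteq> sent_upto R j (events_by R t)"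
      "PROPOSE v y M' j' \<in> received ?s" "safe_proposal P v y M' j'"
      using pbft_inv.voted_sent[OF pbft_inv_run[OF j]] cv by metis
    have "j' = ?l" using y(4) by (simp add: safe_proposal_def)
    then obtain d where "(d, PBFT (PROPOSE v y M' ?l)) \<in> sent_upto R ?l (events_by R t)"
      using received_genuine[OF j y(3)] leader_correct by auto
    moreover have "(j, PBFT (PROPOSE v x M ?l)) \<in> sent_upto R ?l (events_by R t)"
      using m sent_upto_mono[OF events_by_mono[of "L + delta P" t]] t d0 by auto
    ultimately have "PROPOSE v y M' ?l = PROPOSE v x M ?l"
      using pbft_inv.unique[OF pbft_inv_run[OF leader_correct]]
      unfolding unique_slots_def by (metis msg_view.simps(2) same_slot_simps(1))
    then show ?thesis using vt y by simp
  qed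
  obtain Q where Q: "quorum P Q" "Q \<subseteq> correct P" by (rule correct_quorum)
  have committed: "locked_view (state_at t j) = v \<and>
      to_all P (PBFT (COMMITTED v (hash P x) j)) \<subseteq> sent_upto R j (events_by R t)"
    if t: "L + 3 * delta P \<le> t" "t \<le> L + 4 * delta P" and j: "j \<in> correct P" for t j
  proof -
    let ?s = "state_at t j"
    have vt: "voted ?s = Some True" "curr_val ?s = Some x" using voted[of t j] t j d0 by auto
    have cv: "curr_view ?s = v" using stays[of t j] t j d0 by simp
    define C where "C = (\<lambda>q. Prepared v (hash P x) q) ` Q"
    have "PREPARED (Prepared v (hash P x) q) \<in> received ?s" if "q \<in> Q" for q
    proof -
      have q: "q \<in> correct P" using Q(2) that by blast
      have "(j, PBFT (PREPARED (Prepared v (hash P x) q))) \<in> sent_upto R q (events_by R (L + 2 * delta P))"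
        using voted[of "L + 2 * delta P" q] q d0 j correct_procs by (auto simp: to_all_subset_iff)
      then show ?thesis by (rule message_in_view[OF j q]) (use d0 t in simp_all)
    qed
    then have "PREPARED ` C \<subseteq> received ?s" unfolding C_def by blast
    moreover have "prepared P C v (hash P x)" using Q(1) by (auto simp: prepared_def C_def)
    ultimately have "can_lock P ?s x C" unfolding can_lock_def cv using vt by blast
    moreover have "\<not> pending P j ?s" using t d0 by (intro not_pending j) simp_all
    ultimately have lv: "locked_view ?s = v" unfolding pending_def cv by blast
    then obtain y where y: "to_all P (PBFT (COMMITTED v (hash P y) j)) \<subseteq> sent_upto R j (events_by R t)"
      using pbft_inv.locked_sent[OF pbft_inv_run[OF j], of "events_by R t"] view_pos by auto
    then have "(j, PBFT (COMMITTED (curr_view ?s) (hash P y) j)) \<in> sent_upto R j (events_by R t)"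
      using j correct_procs cv by (auto simp: to_all_subset_iff)
    then have "hash P y = hash P x"
      using pbft_inv.committed_once[OF pbft_inv_run[OF j]] vt(2) by force
    then show ?thesis using lv y by simp
  qed
  let ?t = "L + 4 * delta P"
  let ?s = "state_at ?t i"
  have "COMMITTED v (hash P x) q \<in> received ?s" if "q \<in> Q" for q
  proof -
    have q: "q \<in> correct P" using Q(2) that by blast
    have "(i, PBFT (COMMITTED v (hash P x) q)) \<in> sent_upto R q (events_by R (L + 3 * delta P))"
      using committed[of "L + 3 * delta P" q] q d0 i correct_procs by (auto simp: to_all_subset_iff)
    then show ?thesis by (rule message_in_view[OF i q]) (use d0 in simp_all)
  qed
  moreover have cv: "curr_view ?s = v" using stays[of ?t i] i d0 by simp
  moreover have "locked_view ?s = v" using committed[of ?t i] i d0 by simp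
  moreover have "curr_val ?s = Some x" using voted[of ?t i] i d0 by simp
  ultimately have "can_decide P ?s x" unfolding can_decide_def using Q(1) by auto
  moreover have "\<not> pending P i ?s" using d0 by (intro not_pending i) simp_all
  ultimately have "decided ?s \<noteq> None" unfolding pending_def by metis
  then show ?thesis
    using decided_event[OF i, of "events_by R ?t"] less_events_by_iff[of _ ?t]
    unfolding decides_by_def by blast
qed

end

context synchronous_run
begin

lemma correct_leader: "\<exists>v\<in>{1..max_faulty P + 1}. leader P v \<in> correct P"
proof (rule ccontr)
  assume *: "\<not> ?thesis"
  have "leader P v = v" if "v \<in> {1..max_faulty P + 1}" for v
    using that by (auto simp: leader_def)
  then have "{1..max_faulty P + 1} \<subseteq> faulty P"
    using * by (auto simp: faulty_def procs_def)
  from card_mono[OF finite_faulty this] card_faulty show False by simp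
qed

lemma good_view_exists:
  assumes "leader P v \<in> correct P" "1 \<le> v"
  obtains L where "L \<le> S_last P R + (\<Sum>k=1..<v. timeout P k + delta P) + delta P"
    "good_view P R v L"
proof -
  define Y where "Y = S_last P R + (\<Sum>k=1..<v. timeout P k + delta P) + delta P"
  have Y: "entered v Y" using entered_by[OF assms(2)] by (simp add: Y_def)
  then obtain e' where "entry R (leader P v) v e'" using assms(1) by (auto simp: entered_def)
  then obtain e where e: "first_entry v e" using first_entryE[OF assms(1)] by metis
  define L where "L = min Y (time R e + 2 * delta P)"
  have "curr_view (state_at t i) = v"
    if t: "L \<le> t" "t \<le> L + 4 * delta P" and i: "i \<in> correct P" for t i
  proof -
    have lt: "t < time R e + timeout P v"
      using t(2) timeout_bound[OF assms(2)] by (simp add: L_def)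
    show ?thesis
    proof (cases "Y \<le> t")
      case True
      obtain e' where e': "e' < events_by R Y" "entry R i v e'" using Y i by (auto simp: entered_def)
      have "v \<le> curr_view (state_at t i)"
        using curr_view_mono[OF i, of "Suc e'" "events_by R t"] events_by_mono[OF True] e'
        by (simp add: entry_def)
      moreover have "curr_view (state_at t i) \<le> v"
        using view_plus_before_timeout[OF e assms(2) i lt] curr_view_le[OF i, of "events_by R t"]
          view_le[OF i, of "events_by R t"] by simp
      ultimately show ?thesis by simp
    next
      case False
      then have "time R e + 2 * delta P \<le> t" using t(1) by (simp add: L_def min_def split: if_splits)
      then show ?thesis using bounded_entry[OF e assms(2) i _ lt] by simp
    qed
  qed
  then have "good_view P R v L" using assms by unfold_locales auto
  moreover have "L \<le> Y" by (simp add: L_def)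
  ultimately show thesis using that unfolding Y_def by blast
qed

end

theorem corollary52:
  fixes P :: "('v, 'h) params" and R :: "('v, 'h) run"
  assumes "system P"
    and "pbft_fastsync_run P R"
    and "S_first P R \<ge> gst P"
    and "timeout P 1 > 6 * delta P"
  shows "\<forall>i\<in>correct P.
           decides_by R i
             (S_last P R + (\<Sum>k=1..max_faulty P. (timeout P k + delta P)) + 5 * delta P)"
proof
  fix i assume i: "i \<in> correct P"
  interpret synchronous_run P R using assms by unfold_locales
  obtain v where v: "1 \<le> v" "v \<le> max_faulty P + 1" "leader P v \<in> correct P"
    using correct_leader by auto
  obtain L where L: "L \<le> S_last P R + (\<Sum>k=1..<v. timeout P k + delta P) + delta P"
    "good_view P R v L" using good_view_exists[OF v(3,1)] .
  have "(\<Sum>k=1..<v. timeout P k + delta P) \<le> (\<Sum>k=1..max_faulty P. timeout P k + delta P)"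
  proof (rule sum_mono2)
    fix k assume "k \<in> {1..max_faulty P} - {1..<v}"
    then show "0 \<le> timeout P k + delta P" using timeout_bound[of k] delta_nonneg by simp
  qed (use v in auto)
  with L(1) have "L + 4 * delta P \<le> S_last P R + (\<Sum>k=1..max_faulty P. (timeout P k + delta P)) + 5 * delta P"
    by simp
  then show "decides_by R i (S_last P R + (\<Sum>k=1..max_faulty P. (timeout P k + delta P)) + 5 * delta P)"
    using good_view.all_decide[OF L(2) i] unfolding decides_by_def by (meson order_trans)
qed

end
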